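(* Let $\Omega\subset\mathbb{C}^n$ be a Runge domain. The map $$\Phi:\mathcal{F}(\Omega)\to\mathsf{M}(\Omega)$$ defined by $$\Phi(T)(f)(z):=T_z(f_z),\qquad f\in H(\Omega),\ z\in\Omega\setminus\mathcal{N},$$ is an isomorphism between vector spaces. Here $T_z$ is the unique element of $H(z^{-1}\Omega)'$ satisfying $T=T_z$ on $H(\mathbb{C}^n)$, and $f_z(w)=f(zw)$. The multiplier sequence of $\Phi(T)$ coincides with the sequence of moments $(T(\zeta^\alpha))_{\alpha\in\mathbb{N}^n}$ of the analytic functional $T$. The inverse mapping is defined as follows: for any $M\in\mathsf{M}(\Omega)$, the analytic functional $$T=\delta_{\mathbf{1}_n}\circ M:H(\mathbb{C}^n)\to\mathbb{C},$$ that is, $T(f)=M(f)(\mathbf{1}_n)$, where $\delta_{\mathbf{1}_n}$ denotes the point evaluation at $\mathbf{1}_n$, extends to $H(z^{-1}\Omega)$ for every $z\in\Omega\setminus\mathcal{N}$ and satisfies $\Phi(T)=M$.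
   Context: $\mathbb{N}$ includes $0$; $\mathbb{C}_*=\mathbb{C}\setminus\{0\}$; $\mathcal{N}:=\mathbb{C}^n\setminus\mathbb{C}_*^n$ (points with at least one zero coordinate); $\mathbf{1}_n=(1,\dots,1)$. Multiplication in $\mathbb{C}^n$ is coordinatewise, $zw=(z_1w_1,\dots,z_nw_n)$; for $z\in\mathbb{C}_*^n$, $z^{-1}=(1/z_1,\dots,1/z_n)$, and $z^{-1}\Omega=\{z^{-1}w:w\in\Omega\}$. $H(\Omega)$ is the space of holomorphic functions on the open set $\Omega$ with the topology of uniform convergence on compact sets; $H(\Omega)'$ is its dual, whose elements are called analytic functionals. A domain $\Omega\subset\mathbb{C}^n$ is Runge if every holomorphic function on $\Omega$ can be approximated by polynomials uniformly on every compact subset of $\Omega$. A multiplier on $H(\Omega)$ is a continuous linear map $M:H(\Omega)\to H(\Omega)$ such that every monomial is an eigenvector, i.e. for every $\alpha\in\mathbb{N}^n$ there is $m_\alpha\in\mathbb{C}$ with $M(\zeta^\alpha)=m_\alpha\zeta^\alpha$; $(m_\alpha)_\alpha$ is its multiplier sequence. $\mathsf{M}(\Omega)$ is the vector space of all multipliers on $H(\Omega)$. A compact set $K\subset\mathbb{C}^n$ is a carrier of $T\in H(\mathbb{C}^n)'$ if for every open neighbourhood $\omega$ of $K$ there is a constant $C_\omega$ with $|T(f)|\le C_\omega\sup_{\omega}|f|$ for all $f\in H(\mathbb{C}^n)$. $\mathcal{F}(\Omega):=\{T\in H(\mathbb{C}^n)' : T \text{ has a carrier contained in } z^{-1}\Omega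 \text{ for every } z\in\Omega\setminus\mathcal{N}\}$.
   Formalization: Since 1_n need not lie in Ω, M(f)(1_n) for entire f is read as the value at 1_n of the unique entire extension of M(f|Ω), whose existence and uniqueness are proved; it equals the literal M(f)(1_n) whenever 1_n ∈ Ω. *)

theory Defs
  imports "HOL-Analysis.Analysis" "HOL-Library.Function_Algebras"
begin

text \<open>
  Points of \<open>\<complex>\<^sup>n\<close> have type \<^typ>\<open>complex ^ 'n\<close>; the library operations
  \<open>z * w\<close> and \<open>1\<close> on this type are the coordinatewise product and \<open>(1,\<dots>,1)\<close>.
  A function on \<open>\<Omega>\<close> is represented by the total function that vanishes outside \<open>\<Omega>\<close>; likewise
  a map defined on a function space is represented by the map that vanishes outside that space.
  With this convention equality of representatives is equality of the represented maps, and the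
  vector space operations are the pointwise ones.
\<close>

section \<open>Vector spaces of functions and of operators\<close>

definition fscale :: "complex \<Rightarrow> ('a \<Rightarrow> complex) \<Rightarrow> 'a \<Rightarrow> complex" where
  "fscale c f = (\<lambda>x. c * f x)"

definition opscale :: "complex \<Rightarrow> ('b \<Rightarrow> 'a \<Rightarrow> complex) \<Rightarrow> 'b \<Rightarrow> 'a \<Rightarrow> complex" where
  "opscale c M = (\<lambda>f. fscale c (M f))"

lemma vector_space_fscale: "vector_space (fscale :: complex \<Rightarrow> ('a \<Rightarrow> complex) \<Rightarrow> _)"
  by unfold_locales (auto simp: fscale_def fun_eq_iff algebra_simps)

lemma vector_space_opscale:
  "vector_space (opscale :: complex \<Rightarrow> ('b \<Rightarrow> 'a \<Rightarrow> complex) \<Rightarrow> _)"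
  by unfold_locales (auto simp: opscale_def fscale_def fun_eq_iff algebra_simps)

definition lin_on ::
  "(complex \<Rightarrow> 'a \<Rightarrow> 'a) \<Rightarrow> (complex \<Rightarrow> 'b \<Rightarrow> 'b) \<Rightarrow> 'a::ab_group_add set \<Rightarrow> ('a \<Rightarrow> 'b::ab_group_add) \<Rightarrow> bool"
  where
  "lin_on s1 s2 V h \<longleftrightarrow>
     (\<forall>x\<in>V. \<forall>y\<in>V. h (x + y) = h x + h y) \<and> (\<forall>c. \<forall>x\<in>V. h (s1 c x) = s2 c (h x))"

definition vs_iso ::
  "(complex \<Rightarrow> 'a \<Rightarrow> 'a) \<Rightarrow> (complex \<Rightarrow> 'b \<Rightarrow> 'b) \<Rightarrow> 'a::ab_group_add set \<Rightarrow> 'b::ab_group_add set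
    \<Rightarrow> ('a \<Rightarrow> 'b) \<Rightarrow> bool"
  where
  "vs_iso s1 s2 V W h \<longleftrightarrow>
     module.subspace s1 V \<and> module.subspace s2 W \<and> lin_on s1 s2 V h \<and> bij_betw h V W"

section \<open>Holomorphic functions of several variables\<close>

definition hol :: "(complex ^ 'n) set \<Rightarrow> (complex ^ 'n \<Rightarrow> complex) set" where
  "hol \<Omega> = {f. (\<forall>z\<in>\<Omega>. \<exists>D. (f has_derivative D) (at z) \<and> (\<forall>c v. D (c *s v) = c * D v)) \<and>
               (\<forall>z. z \<notin> \<Omega> \<longrightarrow> f z = 0)}"

definition restr :: "(complex ^ 'n) set \<Rightarrow> (complex ^ 'n \<Rightarrow> complex) \<Rightarrow> complex ^ 'n \<Rightarrow> complex" where
  "restr \<Omega> f = (\<lambda>z. if z \<in> \<Omega> then f z else 0)"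

text \<open>The topology of uniform convergence on compact subsets of \<open>\<Omega>\<close>.\<close>

definition hol_open :: "(complex ^ 'n) set \<Rightarrow> (complex ^ 'n \<Rightarrow> complex) set \<Rightarrow> bool" where
  "hol_open \<Omega> U \<longleftrightarrow> U \<subseteq> hol \<Omega> \<and>
     (\<forall>f\<in>U. \<exists>K e. compact K \<and> K \<subseteq> \<Omega> \<and> e > 0 \<and>
        {g \<in> hol \<Omega>. \<forall>z\<in>K. dist (g z) (f z) < e} \<subseteq> U)"

definition hol_top :: "(complex ^ 'n) set \<Rightarrow> (complex ^ 'n \<Rightarrow> complex) topology" where
  "hol_top \<Omega> = topology (hol_open \<Omega>)"

lemma istopology_hol_open:
  fixes \<Omega> :: "(complex ^ 'n) set"
  shows "istopology (hol_open \<Omega>)"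
  unfolding istopology_def
proof (intro conjI allI impI)
  fix S T :: "(complex ^ 'n \<Rightarrow> complex) set"
  assume S: "hol_open \<Omega> S" and T: "hol_open \<Omega> T"
  show "hol_open \<Omega> (S \<inter> T)"
    unfolding hol_open_def
  proof (intro conjI ballI)
    show "S \<inter> T \<subseteq> hol \<Omega>"
      using S by (auto simp: hol_open_def)
    fix f assume f: "f \<in> S \<inter> T"
    obtain K d where K: "compact K" "K \<subseteq> \<Omega>" "d > 0"
        "{g \<in> hol \<Omega>. \<forall>z\<in>K. dist (g z) (f z) < d} \<subseteq> S"
      using S f unfolding hol_open_def by (meson IntD1)
    obtain L e where L: "compact L" "L \<subseteq> \<Omega>" "e > 0"
        "{g \<in> hol \<Omega>. \<forall>z\<in>L. dist (g z) (f z) < e} \<subseteq> T"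
      using T f unfolding hol_open_def by (meson IntD2)
    have "compact (K \<union> L) \<and> K \<union> L \<subseteq> \<Omega> \<and> min d e > 0 \<and>
        {g \<in> hol \<Omega>. \<forall>z\<in>K \<union> L. dist (g z) (f z) < min d e} \<subseteq> S \<inter> T"
      using K L by (auto simp: compact_Un)
    then show "\<exists>K e. compact K \<and> K \<subseteq> \<Omega> \<and> e > 0 \<and>
        {g \<in> hol \<Omega>. \<forall>z\<in>K. dist (g z) (f z) < e} \<subseteq> S \<inter> T"
      by blast
  qed
next
  fix \<K> :: "(complex ^ 'n \<Rightarrow> complex) set set"
  assume "\<forall>S\<in>\<K>. hol_open \<Omega> S"
  then show "hol_open \<Omega> (\<Union>\<K>)"
    unfolding hol_open_def by (meson Sup_least UnionE Union_upper subset_trans)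
qed

lemma openin_hol_top: "openin (hol_top \<Omega>) = hol_open \<Omega>"
  by (simp add: hol_top_def istopology_hol_open topology_inverse')

lemma topspace_hol_top: "topspace (hol_top \<Omega>) = hol \<Omega>"
proof
  show "topspace (hol_top \<Omega>) \<subseteq> hol \<Omega>"
    by (auto simp: topspace_def openin_hol_top hol_open_def)
  have "hol_open \<Omega> (hol \<Omega>)"
    unfolding hol_open_def by (intro conjI ballI exI[of _ "{}"] exI[of _ 1]) auto
  then show "hol \<Omega> \<subseteq> topspace (hol_top \<Omega>)"
    by (metis openin_hol_top openin_subset)
qed

text \<open>The dual of \<open>H(\<Omega>)\<close>; analytic functionals are the elements of \<open>hol_dual UNIV\<close>.\<close>

definition hol_dual :: "(complex ^ 'n) set \<Rightarrow> ((complex ^ 'n \<Rightarrow> complex) \<Rightarrow> complex) set" where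
  "hol_dual \<Omega> = {T. lin_on fscale (*) (hol \<Omega>) T \<and>
                    continuous_map (hol_top \<Omega>) euclidean T \<and> (\<forall>f. f \<notin> hol \<Omega> \<longrightarrow> T f = 0)}"

definition monomial :: "('n \<Rightarrow> nat) \<Rightarrow> complex ^ 'n \<Rightarrow> complex" where
  "monomial \<alpha> z = (\<Prod>i\<in>UNIV. (z $ i) ^ \<alpha> i)"

definition polynomial_fun :: "(complex ^ 'n \<Rightarrow> complex) \<Rightarrow> bool" where
  "polynomial_fun p \<longleftrightarrow> (\<exists>A c. finite A \<and> p = (\<lambda>z. \<Sum>\<alpha>\<in>A. c \<alpha> * monomial \<alpha> z))"

definition runge_domain :: "(complex ^ 'n) set \<Rightarrow> bool" where
  "runge_domain \<Omega> \<longleftrightarrow> open \<Omega> \<and> connected \<Omega> \<and> \<Omega> \<noteq> {} \<and>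
     (\<forall>f\<in>hol \<Omega>. \<forall>K e. compact K \<and> K \<subseteq> \<Omega> \<and> e > 0 \<longrightarrow>
        (\<exists>p. polynomial_fun p \<and> (\<forall>z\<in>K. dist (p z) (f z) < e)))"

section \<open>Multipliers\<close>

definition multiplier_seq ::
  "(complex ^ 'n) set \<Rightarrow> ((complex ^ 'n \<Rightarrow> complex) \<Rightarrow> complex ^ 'n \<Rightarrow> complex) \<Rightarrow> (('n \<Rightarrow> nat) \<Rightarrow> complex) \<Rightarrow> bool"
  where
  "multiplier_seq \<Omega> M m \<longleftrightarrow>
     (\<forall>\<alpha>. M (restr \<Omega> (monomial \<alpha>)) = fscale (m \<alpha>) (restr \<Omega> (monomial \<alpha>)))"

definition multipliers ::
  "(complex ^ 'n) set \<Rightarrow> ((complex ^ 'n \<Rightarrow> complex) \<Rightarrow> complex ^ 'n \<Rightarrow> complex) set" where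
  "multipliers \<Omega> = {M. M ` hol \<Omega> \<subseteq> hol \<Omega> \<and> lin_on fscale fscale (hol \<Omega>) M \<and>
                       continuous_map (hol_top \<Omega>) (hol_top \<Omega>) M \<and>
                       (\<forall>f. f \<notin> hol \<Omega> \<longrightarrow> M f = 0) \<and> (\<exists>m. multiplier_seq \<Omega> M m)}"

section \<open>Carriers and the representation map\<close>

definition zero_coord :: "(complex ^ 'n) set" where
  "zero_coord = {z. \<exists>i. z $ i = 0}"

definition inv_dilate :: "complex ^ 'n \<Rightarrow> (complex ^ 'n) set \<Rightarrow> (complex ^ 'n) set" where
  "inv_dilate z \<Omega> = (\<lambda>w. (\<chi> i. 1 / z $ i) * w) ` \<Omega>"

text \<open>
  The supremum is taken in \<open>[0,\<infinity>]\<close>: it is infinite if \<open>f\<close> is unbounded on \<open>\<omega>\<close>, and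
  \<open>0\<close> if \<open>\<omega>\<close> is empty.
\<close>

definition carrier_of :: "(complex ^ 'n) set \<Rightarrow> ((complex ^ 'n \<Rightarrow> complex) \<Rightarrow> complex) \<Rightarrow> bool" where
  "carrier_of K T \<longleftrightarrow> compact K \<and>
     (\<forall>\<omega>. open \<omega> \<and> K \<subseteq> \<omega> \<longrightarrow>
        (\<exists>C::real. \<forall>f\<in>hol UNIV.
           ennreal (cmod (T f)) \<le> ennreal C * (SUP z\<in>\<omega>. ennreal (cmod (f z)))))"

definition carried_functionals :: "(complex ^ 'n) set \<Rightarrow> ((complex ^ 'n \<Rightarrow> complex) \<Rightarrow> complex) set" where
  "carried_functionals \<Omega> =
     {T \<in> hol_dual UNIV. \<forall>z\<in>\<Omega> - zero_coord. \<exists>K. carrier_of K T \<and> K \<subseteq> inv_dilate z \<Omega>}"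

definition extends_functional ::
  "(complex ^ 'n) set \<Rightarrow> ((complex ^ 'n \<Rightarrow> complex) \<Rightarrow> complex) \<Rightarrow> ((complex ^ 'n \<Rightarrow> complex) \<Rightarrow> complex) \<Rightarrow> bool"
  where
  "extends_functional U T S \<longleftrightarrow> S \<in> hol_dual U \<and> (\<forall>f\<in>hol UNIV. S (restr U f) = T f)"

definition functional_at ::
  "(complex ^ 'n) set \<Rightarrow> ((complex ^ 'n \<Rightarrow> complex) \<Rightarrow> complex) \<Rightarrow> complex ^ 'n
    \<Rightarrow> (complex ^ 'n \<Rightarrow> complex) \<Rightarrow> complex" where
  "functional_at \<Omega> T z = (THE S. extends_functional (inv_dilate z \<Omega>) T S)"

text \<open>
  The formula prescribes \<open>\<Phi>(T)(f)\<close> off the zero coordinates only; \<open>\<Phi>(T)(f)\<close> is the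
  holomorphic function on \<open>\<Omega>\<close> with these values. The function \<open>\<lambda>w. f (z * w)\<close> vanishes
  outside \<open>z\<^sup>-\<^sup>1\<Omega>\<close>, so it is the representative of \<open>f\<^sub>z\<close>.
\<close>

definition Phi_value ::
  "(complex ^ 'n) set \<Rightarrow> ((complex ^ 'n \<Rightarrow> complex) \<Rightarrow> complex) \<Rightarrow> (complex ^ 'n \<Rightarrow> complex)
    \<Rightarrow> (complex ^ 'n \<Rightarrow> complex) \<Rightarrow> bool" where
  "Phi_value \<Omega> T f g \<longleftrightarrow> g \<in> hol \<Omega> \<and>
     (\<forall>z\<in>\<Omega> - zero_coord. g z = functional_at \<Omega> T z (\<lambda>w. f (z * w)))"

definition Phi ::
  "(complex ^ 'n) set \<Rightarrow> ((complex ^ 'n \<Rightarrow> complex) \<Rightarrow> complex)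
    \<Rightarrow> (complex ^ 'n \<Rightarrow> complex) \<Rightarrow> complex ^ 'n \<Rightarrow> complex" where
  "Phi \<Omega> T f = (if f \<in> hol \<Omega> then THE g. Phi_value \<Omega> T f g else 0)"

text \<open>
  The point \<open>1\<close> need not belong to \<open>\<Omega>\<close>. For entire \<open>f\<close> the function \<open>M(f)\<close> has a
  unique entire extension, and \<open>M(f)(1)\<close> is the value of that extension.
\<close>

definition entire_extension ::
  "(complex ^ 'n) set \<Rightarrow> (complex ^ 'n \<Rightarrow> complex) \<Rightarrow> (complex ^ 'n \<Rightarrow> complex) \<Rightarrow> bool" where
  "entire_extension \<Omega> h g \<longleftrightarrow> g \<in> hol UNIV \<and> (\<forall>z\<in>\<Omega>. g z = h z)"

definition delta_one ::
  "(complex ^ 'n) set \<Rightarrow> ((complex ^ 'n \<Rightarrow> complex) \<Rightarrow> complex ^ 'n \<Rightarrow> complex)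
    \<Rightarrow> (complex ^ 'n \<Rightarrow> complex) \<Rightarrow> complex" where
  "delta_one \<Omega> M f =
     (if f \<in> hol UNIV then (THE g. entire_extension \<Omega> (M (restr \<Omega> f)) g) 1 else 0)"

end

theory Submission
  imports Defs "HOL-Complex_Analysis.Complex_Analysis"
begin

text \<open>
  A functional \<open>T\<close> carried by a compact subset of \<open>z\<^sup>-\<^sup>1\<Omega>\<close> is bounded by a supremum over a slightly
  larger compact set, so it extends to \<open>H(z\<^sup>-\<^sup>1\<Omega>)\<close> by density of the polynomials. For a polynomial
  \<open>p\<close> the function \<open>z \<mapsto> T(p(z\<cdot>))\<close> is again a polynomial, and the bounds for \<open>T\<close> make
  \<open>p \<mapsto> T(p(z\<cdot>))\<close> locally uniformly continuous, first off the zero coordinates and then, by the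
  maximum modulus principle on small circles, on all of \<open>\<Omega>\<close>. Hence \<open>\<Phi>(T)(f)\<close> is the locally
  uniform limit of \<open>z \<mapsto> T(p\<^sub>k(z\<cdot>))\<close> for polynomials \<open>p\<^sub>k \<rightarrow> f\<close>. Conversely, for a multiplier \<open>M\<close> the
  functionals \<open>f \<mapsto> M(f(z\<^sup>-\<^sup>1\<cdot>))(z)\<close> on \<open>H(z\<^sup>-\<^sup>1\<Omega>)\<close> all have the multiplier sequence as their
  moments, so they restrict to one and the same functional \<open>T\<close> on entire functions. Since
  multipliers are determined by their sequences, \<open>\<Phi>(T) = M\<close>.
\<close>

section \<open>Coordinatewise multiplication\<close>

text \<open>The compact set attached to \<open>T\<close> depends on \<open>z\<close>, and nothing in
  the definition of a carried functional makes it uniform in \<open>z\<close>. Uniformity comes from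
  looking at products: if \<open>L\<close> is compact in \<open>a\<^sup>-\<^sup>1\<Omega>\<close>,
  then for \<open>z\<close> near \<open>a\<close> and \<open>w\<close> in \<open>L\<close> the
  points \<open>z * w\<close> stay in one compact subset of \<open>\<Omega>\<close>. The resulting
  bounds concern \<open>p\<close> on \<open>\<Omega>\<close>, so a single sequence of polynomials
  serves for all \<open>z\<close>. At points with zero coordinates no carrier is available; the
  passage to them is made for polynomials, where \<open>z \<mapsto> T(p(z\<cdot>))\<close> is
  defined and holomorphic everywhere. Uniqueness of functionals always rests on one principle, that
  moments determine a continuous functional on a Runge domain. It is applied on
  \<open>\<Omega>\<close>, on \<open>z\<^sup>-\<^sup>1\<Omega>\<close> and on the whole space. The
  point \<open>1\<close> may lie outside \<open>\<Omega>\<close>, so \<open>M(f)(1)\<close> calls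
  for an entire extension of \<open>M(f)\<close>. It is found by forming \<open>\<Phi>\<close> over
  the whole space, where every analytic functional is carried.\<close>

lemma norm_vec_times_le:
  fixes a b :: "complex ^ 'n"
  shows "norm (a * b) \<le> norm a * norm b"
proof -
  have "norm (a * b) \<le> L2_set (\<lambda>i. norm a * norm (b $ i)) UNIV"
    unfolding norm_vec_def[of "a * b"]
    by (intro L2_set_mono) (auto simp: norm_mult intro!: mult_right_mono Finite_Cartesian_Product.norm_nth_le)
  also have "\<dots> = norm a * norm b"
    by (simp add: L2_set_right_distrib norm_vec_def[of b])
  finally show ?thesis .
qed

lemma bounded_bilinear_vec_times:
  "bounded_bilinear ((*) :: complex ^ 'n \<Rightarrow> complex ^ 'n \<Rightarrow> complex ^ 'n)"
  by (rule bounded_bilinear.intro)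
     (auto simp: vec_eq_iff algebra_simps intro!: exI[of _ 1] norm_vec_times_le)

lemmas bounded_linear_vec_times = bounded_bilinear.bounded_linear_right[OF bounded_bilinear_vec_times]
lemmas continuous_on_vec_times [continuous_intros] =
  bounded_bilinear.continuous_on[OF bounded_bilinear_vec_times]

lemma norm_vector_smult: "norm (t *s h) = cmod t * norm (h :: complex ^ 'n)"
  unfolding norm_vec_def by (simp add: norm_mult L2_set_right_distrib)

lemma bounded_linear_vector_smult: "bounded_linear (\<lambda>t. t *s (h :: complex ^ 'n))"
  by (rule bounded_linear_intro[where K = "norm h"])
     (auto simp: vec_eq_iff algebra_simps norm_vector_smult)

text \<open>Total by the convention 1/0 = 0; hence the cancellation laws carry the hypothesis
  \<open>z \<notin> zero_coord\<close>.\<close>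

definition vinverse :: "complex ^ 'n \<Rightarrow> complex ^ 'n" where
  "vinverse z = (\<chi> i. 1 / z $ i)"

lemma vinverse_mult: "z \<notin> zero_coord \<Longrightarrow> z * vinverse z = 1" "z \<notin> zero_coord \<Longrightarrow> vinverse z * z = 1"
  by (auto simp: vec_eq_iff vinverse_def zero_coord_def)

lemma vinverse_cancel [simp]:
  assumes "z \<notin> zero_coord"
  shows "z * (vinverse z * w) = w" "vinverse z * (z * w) = w"
  by (simp_all flip: mult.assoc add: vinverse_mult assms)

lemma inv_dilate_eq:
  assumes "z \<notin> zero_coord"
  shows "inv_dilate z \<Omega> = {w. z * w \<in> \<Omega>}"
proof -
  have "inv_dilate z \<Omega> = (\<lambda>w. vinverse z * w) ` \<Omega>"
    by (simp add: inv_dilate_def vinverse_def)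
  also have "\<dots> = {w. z * w \<in> \<Omega>}"
    using assms by (auto simp: image_iff intro!: bexI[of _ "z * _"])
  finally show ?thesis .
qed

lemma open_inv_dilate:
  assumes "z \<notin> zero_coord" "open \<Omega>"
  shows "open (inv_dilate z \<Omega>)"
proof -
  have "continuous_on UNIV (\<lambda>w. z * w)"
    by (intro continuous_intros)
  then show ?thesis
    using open_vimage[OF assms(2)] by (simp add: inv_dilate_eq[OF assms(1)] vimage_def)
qed

text \<open>In the direction \<open>1\<close> every coordinate moves, and coordinate
  \<open>i\<close> vanishes exactly at \<open>t = - z $ i\<close>. A coordinate direction would
  leave the other zeros in place.\<close>

lemma finite_zero_coord_line: "finite {t. z + t *s 1 \<in> zero_coord}"
proof -
  have "{t. z + t *s 1 \<in> zero_coord} \<subseteq> range (\<lambda>i. - z $ i)"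
    by (auto simp: zero_coord_def image_iff add_eq_0_iff)
  then show ?thesis
    by (rule finite_subset) simp
qed

text \<open>The parameters \<open>t\<close> with \<open>z + t *s 1\<close> in
  \<open>\<Omega>\<close> and close to \<open>z\<close> form a nonempty open subset of the plane,
  which is infinite, while only finitely many \<open>t\<close> give a zero coordinate.\<close>

lemma closure_diff_zero_coord:
  fixes \<Omega> :: "(complex ^ 'n) set"
  assumes "open \<Omega>" "z \<in> \<Omega>"
  shows "z \<in> closure (\<Omega> - zero_coord)"
proof -
  have "\<exists>y\<in>\<Omega> - zero_coord. dist y z < e" if "e > 0" for e
  proof -
    have "continuous_on UNIV (\<lambda>t. z + t *s 1)"
      by (intro continuous_intros linear_continuous_on bounded_linear_vector_smult)
    then have "open ((\<lambda>t. z + t *s 1) -` (\<Omega> \<inter> ball z e))"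
      by (intro open_vimage open_Int assms) auto
    moreover have "0 \<in> (\<lambda>t. z + t *s 1) -` (\<Omega> \<inter> ball z e)"
      using assms that by (auto simp: vec_eq_iff)
    ultimately have "infinite ((\<lambda>t. z + t *s 1) -` (\<Omega> \<inter> ball z e))"
      using finite_imp_not_open by blast
    then obtain t where "z + t *s 1 \<in> \<Omega> \<inter> ball z e" "z + t *s 1 \<notin> zero_coord"
      using finite_zero_coord_line[of z] by (metis (mono_tags, lifting) finite_subset mem_Collect_eq subsetI vimage_eq)
    then show ?thesis
      by (auto simp: dist_commute)
  qed
  then show ?thesis
    by (simp add: closure_approachable)
qed

section \<open>Complex differentiability\<close>

text \<open>\<open>D\<close> is a real Frechet derivative; its homogeneity is the Cauchy-Riemann
  condition. Stating it at one point keeps the closure rules free of open sets.\<close>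

definition cdiff :: "(complex ^ 'n \<Rightarrow> complex) \<Rightarrow> complex ^ 'n \<Rightarrow> bool" where
  "cdiff f z \<longleftrightarrow> (\<exists>D. (f has_derivative D) (at z) \<and> (\<forall>c v. D (c *s v) = c * D v))"

lemma hol_iff: "f \<in> hol \<Omega> \<longleftrightarrow> (\<forall>z\<in>\<Omega>. cdiff f z) \<and> (\<forall>z. z \<notin> \<Omega> \<longrightarrow> f z = 0)"
  by (simp add: hol_def cdiff_def)

lemma cdiff_const [simp, intro]: "cdiff (\<lambda>z. c) z"
  unfolding cdiff_def by (intro exI[of _ "\<lambda>_. 0"]) auto

lemma cdiff_nth [simp, intro]: "cdiff (\<lambda>z. z $ i) z"
  unfolding cdiff_def
  by (intro exI[of _ "\<lambda>z. z $ i"]) (auto intro: bounded_linear_imp_has_derivative bounded_linear_vec_nth)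

lemma cdiff_add [intro]: "cdiff f z \<Longrightarrow> cdiff g z \<Longrightarrow> cdiff (\<lambda>z. f z + g z) z"
  unfolding cdiff_def
proof (elim exE conjE)
  fix D E
  assume "(f has_derivative D) (at z)" "\<forall>c v. D (c *s v) = c * D v"
    "(g has_derivative E) (at z)" "\<forall>c v. E (c *s v) = c * E v"
  then show "\<exists>D. ((\<lambda>z. f z + g z) has_derivative D) (at z) \<and> (\<forall>c v. D (c *s v) = c * D v)"
    by (intro exI[of _ "\<lambda>v. D v + E v"]) (auto intro: has_derivative_add simp: algebra_simps)
qed

lemma cdiff_mult [intro]: "cdiff f z \<Longrightarrow> cdiff g z \<Longrightarrow> cdiff (\<lambda>z. f z * g z) z"
  unfolding cdiff_def
proof (elim exE conjE)
  fix D E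
  assume "(f has_derivative D) (at z)" "\<forall>c v. D (c *s v) = c * D v"
    "(g has_derivative E) (at z)" "\<forall>c v. E (c *s v) = c * E v"
  then show "\<exists>D. ((\<lambda>z. f z * g z) has_derivative D) (at z) \<and> (\<forall>c v. D (c *s v) = c * D v)"
    using has_derivative_mult[of f D z UNIV g E]
    by (intro exI[of _ "\<lambda>v. f z * E v + D v * g z"]) (simp add: algebra_simps)
qed

lemma cdiff_sum [intro]: "(\<And>i. i \<in> A \<Longrightarrow> cdiff (f i) z) \<Longrightarrow> cdiff (\<lambda>z. \<Sum>i\<in>A. f i z) z"
  by (induction A rule: infinite_finite_induct) auto

lemma cdiff_power [intro]: "cdiff f z \<Longrightarrow> cdiff (\<lambda>z. f z ^ k) z"
  by (induction k) auto

lemma cdiff_prod [intro]: "(\<And>i. i \<in> A \<Longrightarrow> cdiff (f i) z) \<Longrightarrow> cdiff (\<lambda>z. \<Prod>i\<in>A. f i z) z"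
  by (induction A rule: infinite_finite_induct) auto

lemma cdiff_affine:
  assumes "cdiff f (a + b * z)"
  shows "cdiff (\<lambda>z. f (a + b * z)) z"
proof -
  obtain D where D: "(f has_derivative D) (at (a + b * z))" "\<forall>c v. D (c *s v) = c * D v"
    using assms by (auto simp: cdiff_def)
  have "((\<lambda>z. a + b * z) has_derivative (\<lambda>v. 0 + b * v)) (at z)"
    by (intro has_derivative_add has_derivative_const bounded_linear_imp_has_derivative
        bounded_linear_vec_times)
  then have "((\<lambda>z. f (a + b * z)) has_derivative (\<lambda>v. D (b * v))) (at z)"
    using has_derivative_compose D(1) by fastforce
  moreover have "D (b * (c *s v)) = c * D (b * v)" for c v
  proof -
    have "b * (c *s v) = c *s (b * v)"
      by (simp add: vec_eq_iff)
    then show ?thesis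
      using D(2) by metis
  qed
  ultimately show ?thesis
    unfolding cdiff_def by blast
qed

text \<open>Makes the zero extension harmless: at a point of an open \<open>\<Omega>\<close> a
  representative and the function it stands for agree nearby.\<close>

lemma cdiff_cong_open:
  assumes "cdiff f z" "open U" "z \<in> U" "\<And>w. w \<in> U \<Longrightarrow> g w = f w"
  shows "cdiff g z"
  using assms unfolding cdiff_def by (metis has_derivative_transform_within_open)

lemma cdiff_isCont: "cdiff f z \<Longrightarrow> isCont f z"
  unfolding cdiff_def using has_derivative_continuous by blast

text \<open>Homogeneity turns the derivative \<open>s \<mapsto> D (s *s h)\<close> into
  multiplication by \<open>D h\<close>, which opens complex lines to one-variable theory.\<close>

lemma cdiff_line:
  fixes f :: "complex ^ 'n \<Rightarrow> complex"
  assumes "(f has_derivative D) (at (z + t *s h))" "\<forall>c v. D (c *s v) = c * D v"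
  shows "((\<lambda>t. f (z + t *s h)) has_field_derivative D h) (at t)"
proof -
  have "((\<lambda>t. z + t *s h) has_derivative (\<lambda>s. 0 + s *s h)) (at t)"
    by (intro has_derivative_add has_derivative_const bounded_linear_imp_has_derivative
        bounded_linear_vector_smult)
  then have "((\<lambda>t. f (z + t *s h)) has_derivative (\<lambda>s. D (s *s h))) (at t)"
    using has_derivative_compose assms(1) by fastforce
  moreover have "(\<lambda>s. D (s *s h)) = (*) (D h)"
    using assms(2) by (auto simp: fun_eq_iff mult.commute)
  ultimately show ?thesis
    by (simp add: has_field_derivative_def)
qed

lemma cdiff_line_holomorphic:
  assumes "\<And>t. t \<in> S \<Longrightarrow> cdiff f (z + t *s h)"
  shows "(\<lambda>t. f (z + t *s h)) holomorphic_on S"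
  unfolding holomorphic_on_def field_differentiable_def
proof
  fix t assume "t \<in> S"
  then obtain D where D: "(f has_derivative D) (at (z + t *s h))" "\<forall>c v. D (c *s v) = c * D v"
    using assms[of t] by (auto simp: cdiff_def)
  then show "\<exists>f'. ((\<lambda>t. f (z + t *s h)) has_field_derivative f') (at t within S)"
    using cdiff_line has_field_derivative_at_within by blast
qed

text \<open>The one-variable Cauchy inequality on the complex line through \<open>z\<close> in
  direction \<open>h\<close>. A bound linear in \<open>norm h\<close> is the form in which
  convergence of derivatives is needed later.\<close>

lemma cdiff_Cauchy_estimate:
  assumes "r > 0" "\<And>w. w \<in> cball z r \<Longrightarrow> cdiff f w" "\<And>w. w \<in> cball z r \<Longrightarrow> cmod (f w) \<le> B"
    and D: "(f has_derivative D) (at z)" "\<forall>c v. D (c *s v) = c * D v"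
  shows "cmod (D h) \<le> B / r * norm h"
proof (cases "h = 0")
  case True
  then show ?thesis
    using linear_0[OF has_derivative_linear[OF D(1)]] by simp
next
  case False
  \<comment> \<open>With this radius the parameter disc \<open>cball 0 R\<close> is mapped into
    \<open>cball z r\<close>; the division is why \<open>h = 0\<close> is treated apart.\<close>
  define R where "R = r / norm h"
  have R: "R > 0"
    using False assms(1) by (simp add: R_def)
  have line: "z + t *s h \<in> cball z r" if "t \<in> cball 0 R" for t
    using that False by (simp add: dist_norm norm_vector_smult R_def field_simps)
  have hol: "(\<lambda>t. f (z + t *s h)) holomorphic_on cball 0 R"
    by (intro cdiff_line_holomorphic assms(2) line)
  have "norm ((deriv ^^ 1) (\<lambda>t. f (z + t *s h)) 0) \<le> fact 1 * B / R ^ 1"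
  proof (rule Cauchy_inequality)
    show "(\<lambda>t. f (z + t *s h)) holomorphic_on ball 0 R"
      using hol ball_subset_cball holomorphic_on_subset by blast
    show "continuous_on (cball 0 R) (\<lambda>t. f (z + t *s h))"
      using hol by (rule holomorphic_on_imp_continuous_on)
  qed (use R in \<open>auto intro!: assms(3) line\<close>)
  moreover have "deriv (\<lambda>t. f (z + t *s h)) 0 = D h"
    using D by (intro DERIV_imp_deriv cdiff_line) auto
  ultimately show ?thesis
    by (simp add: R_def field_simps)
qed

text \<open>The bound is asked for on one circle of one line, and such a circle can avoid the zero
  coordinates even when \<open>z\<close> has some.\<close>

lemma cdiff_line_maximum_modulus:
  assumes "r > 0" "\<And>t. t \<in> cball 0 r \<Longrightarrow> cdiff f (z + t *s h)"
    "\<And>t. cmod t = r \<Longrightarrow> cmod (f (z + t *s h)) \<le> B"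
  shows "cmod (f z) \<le> B"
proof -
  have hol: "(\<lambda>t. f (z + t *s h)) holomorphic_on cball 0 r"
    by (intro cdiff_line_holomorphic assms(2))
  have "cmod ((\<lambda>t. f (z + t *s h)) 0) \<le> B"
  proof (rule maximum_modulus_frontier[where S = "cball 0 r" and f = "\<lambda>t. f (z + t *s h)"])
    show "(\<lambda>t. f (z + t *s h)) holomorphic_on interior (cball 0 r)"
      using hol interior_subset holomorphic_on_subset by blast
    show "continuous_on (closure (cball 0 r)) (\<lambda>t. f (z + t *s h))"
      using hol by (simp add: holomorphic_on_imp_continuous_on)
  qed (use assms in \<open>auto simp: frontier_cball\<close>)
  then show ?thesis
    by simp
qed

section \<open>The spaces of holomorphic functions\<close>

lemma hol_cdiff: "f \<in> hol \<Omega> \<Longrightarrow> z \<in> \<Omega> \<Longrightarrow> cdiff f z"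
  by (simp add: hol_iff)

lemma hol_outside: "f \<in> hol \<Omega> \<Longrightarrow> z \<notin> \<Omega> \<Longrightarrow> f z = 0"
  by (simp add: hol_iff)

lemma hol_add: "f \<in> hol \<Omega> \<Longrightarrow> g \<in> hol \<Omega> \<Longrightarrow> f + g \<in> hol \<Omega>"
  by (auto simp: hol_iff plus_fun_def)

lemma hol_fscale: "f \<in> hol \<Omega> \<Longrightarrow> fscale c f \<in> hol \<Omega>"
  by (auto simp: hol_iff fscale_def)

lemma hol_zero: "0 \<in> hol \<Omega>"
  by (auto simp: hol_iff zero_fun_def)

lemma hol_sum:
  assumes "\<And>i. i \<in> A \<Longrightarrow> f i \<in> hol \<Omega>"
  shows "(\<lambda>w. \<Sum>i\<in>A. c i * f i w) \<in> hol \<Omega>"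
proof -
  have "cdiff (\<lambda>w. \<Sum>i\<in>A. c i * f i w) z" if "z \<in> \<Omega>" for z
    using that assms by (intro cdiff_sum cdiff_mult cdiff_const) (auto intro: hol_cdiff)
  then show ?thesis
    using assms by (auto simp: hol_iff)
qed

lemma hol_isCont: "f \<in> hol \<Omega> \<Longrightarrow> z \<in> \<Omega> \<Longrightarrow> isCont f z"
  by (intro cdiff_isCont hol_cdiff)

lemma hol_continuous_on: "f \<in> hol \<Omega> \<Longrightarrow> continuous_on \<Omega> f"
  by (meson continuous_at_imp_continuous_on hol_isCont)

lemma restr_hol:
  assumes "f \<in> hol V" "open \<Omega>" "\<Omega> \<subseteq> V"
  shows "restr \<Omega> f \<in> hol \<Omega>"
proof -
  have "cdiff (restr \<Omega> f) z" if "z \<in> \<Omega>" for z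
  proof (rule cdiff_cong_open[where U = \<Omega> and f = f])
    show "cdiff f z"
      using that assms by (intro hol_cdiff[OF assms(1)]) auto
  qed (use that assms in \<open>auto simp: restr_def\<close>)
  then show ?thesis
    by (auto simp: hol_iff restr_def)
qed

lemma hol_dilate:
  assumes "f \<in> hol \<Omega>" "z \<notin> zero_coord"
  shows "(\<lambda>w. f (z * w)) \<in> hol (inv_dilate z \<Omega>)"
proof -
  have "cdiff (\<lambda>w. f (0 + z * w)) w" if "z * w \<in> \<Omega>" for w
    using that assms(1) by (intro cdiff_affine) (auto intro: hol_cdiff)
  then show ?thesis
    using assms by (auto simp: hol_iff inv_dilate_eq)
qed

lemma hol_undilate:
  assumes "f \<in> hol (inv_dilate z \<Omega>)" "z \<notin> zero_coord"
  shows "(\<lambda>w. f (vinverse z * w)) \<in> hol \<Omega>"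
proof -
  have "cdiff (\<lambda>w. f (0 + vinverse z * w)) w" if "w \<in> \<Omega>" for w
    using that assms by (intro cdiff_affine) (auto intro!: hol_cdiff simp: inv_dilate_eq)
  then show ?thesis
    using assms by (auto simp: hol_iff inv_dilate_eq)
qed

lemma hol_UNIV_affine:
  assumes "f \<in> hol UNIV"
  shows "(\<lambda>w. f (a + b * w)) \<in> hol UNIV"
  using assms by (auto simp: hol_iff intro: cdiff_affine)

text \<open>Points without zero coordinates are dense in \<open>\<Omega>\<close>, both functions are
  continuous there, and both representatives vanish outside. This settles uniqueness of
  \<open>\<Phi>(T)(f)\<close>, whose formula covers such points only.\<close>

lemma hol_eqI_off_zero_coord:
  assumes "open \<Omega>" "f \<in> hol \<Omega>" "g \<in> hol \<Omega>" "\<And>z. z \<in> \<Omega> - zero_coord \<Longrightarrow> f z = g z"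
  shows "f = g"
proof
  fix z
  show "f z = g z"
  proof (cases "z \<in> \<Omega>")
    case True
    have lim: "z islimpt (\<Omega> - zero_coord) \<or> z \<in> \<Omega> - zero_coord"
      using closure_diff_zero_coord[OF assms(1) True] by (auto simp: closure_def)
    moreover have "f z = g z" if "z islimpt (\<Omega> - zero_coord)"
    proof -
      have nt: "at z within (\<Omega> - zero_coord) \<noteq> bot"
        using that by (simp add: trivial_limit_within)
      have f: "(f \<longlongrightarrow> f z) (at z within (\<Omega> - zero_coord))"
        using hol_isCont[OF assms(2) True] continuous_at_imp_continuous_at_within continuous_within by blast
      have g: "(g \<longlongrightarrow> g z) (at z within (\<Omega> - zero_coord))"
        using hol_isCont[OF assms(3) True] continuous_at_imp_continuous_at_within continuous_within by blast
      have "\<forall>\<^sub>F w in at z within (\<Omega> - zero_coord). f w = g w"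
        using assms(4) by (auto simp: eventually_at intro!: exI[of _ 1])
      then have "(g \<longlongrightarrow> f z) (at z within (\<Omega> - zero_coord))"
        using f tendsto_cong by fastforce
      then show ?thesis
        using g nt tendsto_unique by blast
    qed
    ultimately show ?thesis
      using assms(4) by blast
  qed (use assms in \<open>simp add: hol_outside\<close>)
qed

text \<open>Identity theorem on the complex line from a point of \<open>\<Omega>\<close> at
  \<open>t = 0\<close> to an arbitrary \<open>w\<close> at \<open>t = 1\<close>: the parameters
  mapped into \<open>\<Omega>\<close> form a nonempty open set.\<close>

lemma hol_UNIV_eqI:
  fixes f g :: "complex ^ 'n \<Rightarrow> complex"
  assumes "open \<Omega>" "\<Omega> \<noteq> {}" "f \<in> hol UNIV" "g \<in> hol UNIV" "\<And>z. z \<in> \<Omega> \<Longrightarrow> f z = g z"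
  shows "f = g"
proof
  fix w
  obtain z where z: "z \<in> \<Omega>"
    using assms(2) by blast
  define l where "l = (\<lambda>t. z + t *s (w - z))"
  have hol: "(\<lambda>t. f (l t)) holomorphic_on UNIV" "(\<lambda>t. g (l t)) holomorphic_on UNIV"
    unfolding l_def using assms(3,4) by (intro cdiff_line_holomorphic; simp add: hol_cdiff)+
  have "continuous_on UNIV l"
    unfolding l_def by (intro continuous_intros linear_continuous_on bounded_linear_vector_smult)
  then have op: "open (l -` \<Omega>)"
    using assms(1) open_vimage by blast
  have "(\<lambda>t. f (l t)) 1 = (\<lambda>t. g (l t)) 1"
  proof (rule analytic_continuation_open[where s = "l -` \<Omega>" and s' = UNIV and f = "\<lambda>t. f (l t)" and g = "\<lambda>t. g (l t)"])
    show "l -` \<Omega> \<noteq> {}"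
      using z by (auto simp: l_def set_eq_iff intro!: exI[of _ 0])
  qed (use op hol assms(5) in auto)
  then show "f w = g w"
    by (simp add: l_def)
qed

section \<open>Locally uniform limits\<close>

text \<open>The Weierstrass theorem. The Cauchy estimate turns closeness of \<open>P m\<close> and
  \<open>P k\<close> into closeness of their derivatives on a smaller ball; then termwise
  differentiation applies, and homogeneity passes to the limit.\<close>

lemma hol_locally_uniform_limit:
  fixes P :: "nat \<Rightarrow> complex ^ 'n \<Rightarrow> complex"
  assumes "open \<Omega>" and P: "\<And>k z. z \<in> \<Omega> \<Longrightarrow> cdiff (P k) z"
    and cau: "\<And>Q. compact Q \<Longrightarrow> Q \<subseteq> \<Omega> \<Longrightarrow> uniformly_Cauchy_on Q P"
  shows "\<exists>g\<in>hol \<Omega>. \<forall>z\<in>\<Omega>. (\<lambda>k. P k z) \<longlonglongrightarrow> g z"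
proof -
  have ex: "\<exists>D. ((P k has_derivative D) (at z) \<and> (\<forall>c v. D (c *s v) = c * D v))" if "z \<in> \<Omega>" for k z
    using P[OF that] by (simp add: cdiff_def)
  define D where "D = (\<lambda>k z. SOME D. (P k has_derivative D) (at z) \<and> (\<forall>c v. D (c *s v) = c * D v))"
  have D: "(P k has_derivative D k z) (at z)" "\<forall>c v. D k z (c *s v) = c * D k z v"
    if "z \<in> \<Omega>" for k z
    using someI_ex[OF ex[OF that, of k]] by (auto simp: D_def)
  have conv: "convergent (\<lambda>k. P k z)" if "z \<in> \<Omega>" for z
    using uniformly_Cauchy_imp_Cauchy[OF cau[of "{z}"]] that Cauchy_convergent_iff by auto
  define g where "g = restr \<Omega> (\<lambda>z. lim (\<lambda>k. P k z))"
  have g: "(\<lambda>k. P k z) \<longlonglongrightarrow> g z" if "z \<in> \<Omega>" for z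
    using conv[OF that] that by (simp add: g_def restr_def convergent_LIMSEQ_iff)
  have "cdiff g z" if z: "z \<in> \<Omega>" for z
  proof -
    obtain s where s: "s > 0" "cball z s \<subseteq> \<Omega>"
      using assms(1) z open_contains_cball by blast
    \<comment> \<open>A closed ball of radius \<open>r\<close> about any point of
      \<open>ball z r\<close> still lies in \<open>cball z s\<close>, where the sequence is
      uniformly Cauchy.\<close>
    define r where "r = s / 2"
    have r: "r > 0"
      using s by (simp add: r_def)
    have sub: "cball x r \<subseteq> cball z s" if "x \<in> ball z r" for x
    proof
      fix y assume "y \<in> cball x r"
      then show "y \<in> cball z s"
        using that dist_triangle[of z y x] by (simp add: r_def)
    qed
    have inO: "x \<in> \<Omega>" if "x \<in> ball z r" for x
      using sub[OF that] s(2) r by (meson centre_in_cball less_imp_le subsetD)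
    have Dcau: "\<exists>N. \<forall>m\<ge>N. \<forall>k\<ge>N. \<forall>x\<in>ball z r. \<forall>h. cmod (D m x h - D k x h) \<le> e * norm h"
      if e: "e > 0" for e
    proof -
      \<comment> \<open>The tolerance \<open>e * r\<close> absorbs the factor \<open>1 / r\<close>
        of the Cauchy estimate.\<close>
      obtain N where N: "\<forall>x\<in>cball z s. \<forall>m\<ge>N. \<forall>k\<ge>N. dist (P m x) (P k x) < e * r"
        using cau[of "cball z s"] s(2) e r unfolding uniformly_Cauchy_on_def
        by (meson compact_cball mult_pos_pos)
      have "cmod (D m x h - D k x h) \<le> e * norm h" if "m \<ge> N" "k \<ge> N" "x \<in> ball z r" for m k x h
      proof -
        have "cmod ((\<lambda>h. D m x h - D k x h) h) \<le> (e * r) / r * norm h"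
        proof (rule cdiff_Cauchy_estimate[where f = "\<lambda>x. P m x - P k x" and z = x, OF r])
          fix w assume "w \<in> cball x r"
          then have w: "w \<in> cball z s"
            using sub that(3) by blast
          then show "cmod (P m w - P k w) \<le> e * r"
            using N that(1,2) by (auto simp: dist_norm less_imp_le)
          have "w \<in> \<Omega>"
            using w s(2) by blast
          then have "cdiff (\<lambda>x. P m x + (- 1) * P k x) w"
            by (intro cdiff_add cdiff_mult cdiff_const P)
          then show "cdiff (\<lambda>x. P m x - P k x) w"
            by simp
        next
          show "((\<lambda>x. P m x - P k x) has_derivative (\<lambda>h. D m x h - D k x h)) (at x)"
            using inO[OF that(3)] D by (intro has_derivative_diff) auto
          show "\<forall>c v. D m x (c *s v) - D k x (c *s v) = c * (D m x v - D k x v)"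
            using inO[OF that(3)] D by (simp add: algebra_simps)
        qed
        then show ?thesis
          using r by simp
      qed
      then show ?thesis
        by blast
    qed
    have Dconv: "convergent (\<lambda>k. D k x h)" if x: "x \<in> ball z r" for x h
    proof -
      have "Cauchy (\<lambda>k. D k x h)"
        unfolding Cauchy_altdef2 dist_norm
      proof (intro allI impI)
        fix e :: real assume "e > 0"
        \<comment> \<open>The summand 1 covers \<open>h = 0\<close>.\<close>
        then have "e / (norm h + 1) > 0"
          by (simp add: add_nonneg_pos)
        then obtain N where N: "\<forall>m\<ge>N. \<forall>k\<ge>N. cmod (D m x h - D k x h) \<le> e / (norm h + 1) * norm h"
          using Dcau x by meson
        have "e / (norm h + 1) * norm h < e"
          using \<open>e > 0\<close> by (simp add: field_simps add_pos_nonneg)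
        then show "\<exists>N. \<forall>n\<ge>N. norm (D n x h - D N x h) < e"
          using N by (meson le_less_trans order_refl)
      qed
      then show ?thesis
        by (simp add: Cauchy_convergent_iff)
    qed
    define G where "G = (\<lambda>x h. lim (\<lambda>k. D k x h))"
    have G: "(\<lambda>k. D k x h) \<longlonglongrightarrow> G x h" if "x \<in> ball z r" for x h
      using Dconv[OF that] by (simp add: G_def convergent_LIMSEQ_iff)
    have "\<exists>g'. \<forall>x\<in>ball z r. (\<lambda>k. P k x) \<longlonglongrightarrow> g' x \<and> (g' has_derivative G x) (at x within ball z r)"
    proof (rule has_derivative_sequence)
      show "(P k has_derivative D k x) (at x within ball z r)" if "x \<in> ball z r" for k x
        using D(1) inO[OF that] has_derivative_at_withinI by blast
      show "z \<in> ball z r" "(\<lambda>k. P k z) \<longlonglongrightarrow> g z"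
        using r g z by auto
      fix e :: real assume "e > 0"
      then obtain N where N: "\<forall>m\<ge>N. \<forall>k\<ge>N. \<forall>x\<in>ball z r. \<forall>h. cmod (D m x h - D k x h) \<le> e * norm h"
        using Dcau by meson
      have "cmod (D m x h - G x h) \<le> e * norm h" if "m \<ge> N" "x \<in> ball z r" for m x h
      proof (rule tendsto_upperbound)
        show "(\<lambda>k. cmod (D m x h - D k x h)) \<longlonglongrightarrow> cmod (D m x h - G x h)"
          using G[OF that(2)] by (intro tendsto_intros)
        show "\<forall>\<^sub>F k in sequentially. cmod (D m x h - D k x h) \<le> e * norm h"
          unfolding eventually_sequentially using N that by blast
      qed auto
      then show "\<forall>\<^sub>F n in sequentially. \<forall>x\<in>ball z r. \<forall>h. cmod (D n x h - G x h) \<le> e * norm h"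
        unfolding eventually_sequentially by blast
    qed auto
    then obtain g' where g': "\<And>x. x \<in> ball z r \<Longrightarrow> (\<lambda>k. P k x) \<longlonglongrightarrow> g' x"
      "(g' has_derivative G z) (at z within ball z r)"
      using r by force
    \<comment> \<open>\<open>g'\<close> is controlled only on the ball, where it is the same
      pointwise limit as \<open>g\<close>; this suffices for differentiability at
      \<open>z\<close>.\<close>
    have "g x = g' x" if "x \<in> ball z r" for x
      using g g'(1) inO that LIMSEQ_unique by blast
    moreover have "cdiff g' z"
      unfolding cdiff_def
    proof (intro exI conjI allI)
      show "(g' has_derivative G z) (at z)"
        using g'(2) r at_within_open[of z "ball z r"] by simp
      fix c v
      have "(\<lambda>k. D k z (c *s v)) \<longlonglongrightarrow> c * G z v"
        using G[of z v] r D(2)[OF z] by (auto intro: tendsto_mult_left)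
      then show "G z (c *s v) = c * G z v"
        using G[of z "c *s v"] r LIMSEQ_unique by fastforce
    qed
    ultimately show ?thesis
      using r by (intro cdiff_cong_open[of g' z "ball z r" g]) auto
  qed
  then have "g \<in> hol \<Omega>"
    by (auto simp: hol_iff g_def restr_def)
  then show ?thesis
    using g by blast
qed

section \<open>Polynomials\<close>

lemma polynomial_fun_cmonomial: "polynomial_fun (\<lambda>z. c * monomial \<alpha> z)"
  unfolding polynomial_fun_def by (intro exI[of _ "{\<alpha>}"] exI[of _ "\<lambda>_. c"]) simp

lemma polynomial_fun_monomial: "polynomial_fun (monomial \<alpha>)"
  using polynomial_fun_cmonomial[of 1 \<alpha>] by simp

lemma polynomial_fun_const: "polynomial_fun (\<lambda>z. c)"
  using polynomial_fun_cmonomial[of c "\<lambda>_. 0"] by (simp add: monomial_def)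

lemma polynomial_fun_add:
  fixes p q :: "complex ^ 'n \<Rightarrow> complex"
  assumes "polynomial_fun p" "polynomial_fun q"
  shows "polynomial_fun (\<lambda>z. p z + q z)"
proof -
  obtain A c where A: "finite A" "p = (\<lambda>z. \<Sum>\<alpha>\<in>A. c \<alpha> * monomial \<alpha> z)"
    using assms(1) by (auto simp: polynomial_fun_def)
  obtain B d where B: "finite B" "q = (\<lambda>z. \<Sum>\<alpha>\<in>B. d \<alpha> * monomial \<alpha> z)"
    using assms(2) by (auto simp: polynomial_fun_def)
  \<comment> \<open>Both coefficient families, padded by 0, on the common index set
    \<open>A \<union> B\<close>.\<close>
  define e where "e = (\<lambda>\<alpha>. (if \<alpha> \<in> A then c \<alpha> else 0) + (if \<alpha> \<in> B then d \<alpha> else 0))"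
  have "p z = (\<Sum>\<alpha>\<in>A \<union> B. (if \<alpha> \<in> A then c \<alpha> else 0) * monomial \<alpha> z)" for z
    unfolding A(2) using A(1) B(1) by (intro sum.mono_neutral_cong_left) auto
  moreover have "q z = (\<Sum>\<alpha>\<in>A \<union> B. (if \<alpha> \<in> B then d \<alpha> else 0) * monomial \<alpha> z)" for z
    unfolding B(2) using A(1) B(1) by (intro sum.mono_neutral_cong_left) auto
  ultimately have "(\<lambda>z. p z + q z) = (\<lambda>z. \<Sum>\<alpha>\<in>A \<union> B. e \<alpha> * monomial \<alpha> z)"
    by (simp add: e_def distrib_right sum.distrib)
  then show ?thesis
    unfolding polynomial_fun_def using A(1) B(1) by blast
qed

lemma polynomial_fun_sum:
  "(\<And>i. i \<in> A \<Longrightarrow> polynomial_fun (f i)) \<Longrightarrow> polynomial_fun (\<lambda>z. \<Sum>i\<in>A. f i z)"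
  by (induction A rule: infinite_finite_induct) (auto intro: polynomial_fun_add polynomial_fun_const)

lemma monomial_mult: "monomial \<alpha> z * monomial \<beta> z = monomial (\<lambda>i. \<alpha> i + \<beta> i) z"
  by (simp add: monomial_def power_add prod.distrib)

text \<open>Different pairs of exponents may have the same sum, so the expanded product is not yet
  indexed by exponents; it is read as a finite sum of polynomials instead.\<close>

lemma polynomial_fun_mult:
  fixes p q :: "complex ^ 'n \<Rightarrow> complex"
  assumes "polynomial_fun p" "polynomial_fun q"
  shows "polynomial_fun (\<lambda>z. p z * q z)"
proof -
  obtain A c where A: "finite A" "p = (\<lambda>z. \<Sum>\<alpha>\<in>A. c \<alpha> * monomial \<alpha> z)"
    using assms(1) by (auto simp: polynomial_fun_def)
  obtain B d where B: "finite B" "q = (\<lambda>z. \<Sum>\<alpha>\<in>B. d \<alpha> * monomial \<alpha> z)"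
    using assms(2) by (auto simp: polynomial_fun_def)
  have "(\<lambda>z. p z * q z) = (\<lambda>z. \<Sum>\<alpha>\<in>A. \<Sum>\<beta>\<in>B. (c \<alpha> * d \<beta>) * monomial (\<lambda>i. \<alpha> i + \<beta> i) z)"
    by (simp add: A(2) B(2) sum_product algebra_simps flip: monomial_mult)
  then show ?thesis
    by (simp only:) (intro polynomial_fun_sum polynomial_fun_cmonomial)
qed

lemma polynomial_fun_nth: "polynomial_fun (\<lambda>z. z $ i)"
proof -
  have "(\<lambda>z. z $ i) = monomial (\<lambda>j. if j = i then 1 else 0)"
    by (simp add: monomial_def fun_eq_iff if_distrib prod.delta cong: if_cong)
  then show ?thesis
    by (simp add: polynomial_fun_monomial)
qed

lemma polynomial_fun_power: "polynomial_fun p \<Longrightarrow> polynomial_fun (\<lambda>z. p z ^ k)"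
  by (induction k) (auto intro: polynomial_fun_const polynomial_fun_mult)

lemma polynomial_fun_prod:
  "(\<And>i. i \<in> A \<Longrightarrow> polynomial_fun (f i)) \<Longrightarrow> polynomial_fun (\<lambda>z. \<Prod>i\<in>A. f i z)"
  by (induction A rule: infinite_finite_induct) (auto intro: polynomial_fun_mult polynomial_fun_const)

lemma polynomial_fun_affine:
  assumes "polynomial_fun p"
  shows "polynomial_fun (\<lambda>z. p (a + b * z))"
proof -
  obtain A c where A: "finite A" "p = (\<lambda>z. \<Sum>\<alpha>\<in>A. c \<alpha> * monomial \<alpha> z)"
    using assms by (auto simp: polynomial_fun_def)
  have "(\<lambda>z. p (a + b * z)) = (\<lambda>z. \<Sum>\<alpha>\<in>A. c \<alpha> * (\<Prod>i\<in>UNIV. (a $ i + b $ i * z $ i) ^ \<alpha> i))"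
    by (simp add: A(2) monomial_def)
  then show ?thesis
    by (simp only:) (intro polynomial_fun_sum polynomial_fun_mult polynomial_fun_prod
        polynomial_fun_power polynomial_fun_add polynomial_fun_const polynomial_fun_nth)
qed

lemma cdiff_monomial: "cdiff (monomial \<alpha>) z"
  unfolding monomial_def by (intro cdiff_prod cdiff_power cdiff_nth)

lemma monomial_hol: "monomial \<alpha> \<in> hol UNIV"
  by (simp add: hol_iff cdiff_monomial)

lemma polynomial_fun_hol:
  assumes "polynomial_fun p"
  shows "p \<in> hol UNIV"
proof -
  obtain A c where A: "p = (\<lambda>z. \<Sum>\<alpha>\<in>A. c \<alpha> * monomial \<alpha> z)"
    using assms by (auto simp: polynomial_fun_def)
  show ?thesis
    unfolding A by (intro hol_sum monomial_hol)
qed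

lemma monomial_dilate: "monomial \<alpha> (z * w) = monomial \<alpha> z * monomial \<alpha> w"
  by (simp add: monomial_def power_mult_distrib prod.distrib)

lemma monomial_nonzero: "z \<notin> zero_coord \<Longrightarrow> monomial \<alpha> z \<noteq> 0"
  by (auto simp: monomial_def zero_coord_def)

section \<open>Runge domains\<close>

lemma runge_domain_approx:
  assumes "runge_domain \<Omega>" "f \<in> hol \<Omega>" "compact K" "K \<subseteq> \<Omega>" "e > 0"
  obtains p where "polynomial_fun p" "\<And>z. z \<in> K \<Longrightarrow> dist (p z) (f z) < e"
proof -
  have "\<exists>p. polynomial_fun p \<and> (\<forall>z\<in>K. dist (p z) (f z) < e)"
    using assms by (simp add: runge_domain_def)
  then show ?thesis
    using that by blast
qed

lemma runge_domain_open: "runge_domain \<Omega> \<Longrightarrow> open \<Omega>"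
  by (simp add: runge_domain_def)

text \<open>Any compact set is moved into \<open>\<Omega>\<close> by a suitable affine map, so that the approximation
  property of \<open>\<Omega>\<close> passes to the whole space.\<close>

lemma runge_domain_UNIV:
  fixes \<Omega> :: "(complex ^ 'n) set"
  assumes "runge_domain \<Omega>"
  shows "runge_domain (UNIV :: (complex ^ 'n) set)"
  unfolding runge_domain_def
proof (intro conjI ballI allI impI; (elim conjE)?)
  fix f :: "complex ^ 'n \<Rightarrow> complex" and K :: "(complex ^ 'n) set" and e
  assume f: "f \<in> hol UNIV" and K: "compact K" and e: "(e :: real) > 0"
  obtain a where a: "a \<in> \<Omega>"
    using assms by (auto simp: runge_domain_def)
  obtain s where s: "s > 0" "cball a s \<subseteq> \<Omega>"
    using runge_domain_open[OF assms] a open_contains_cball by blast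
  obtain R where R: "R > 0" "K \<subseteq> cball 0 R"
    using compact_imp_bounded[OF K] bounded_pos by (metis bounded_iff mem_cball_0 subsetI)
  \<comment> \<open>The factor shrinks \<open>cball 0 R\<close>, which contains \<open>K\<close>, to
    the radius \<open>s\<close> of a ball inside \<open>\<Omega>\<close>.\<close>
  define c where "c = complex_of_real (s / R)"
  have c: "c \<noteq> 0" "cmod c = s / R"
    using s R by (auto simp: c_def norm_divide)
  define b where "b = (\<chi> i::'n. c)"
  have b: "b \<notin> zero_coord"
    using c by (auto simp: b_def zero_coord_def)
  define A where "A = (\<lambda>w. a + b * w)"
  have A: "A w \<in> \<Omega>" if "w \<in> K" for w
  proof -
    have "b * w = c *s w"
      by (simp add: b_def vec_eq_iff)
    then have "norm (b * w) = s / R * norm w"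
      using c by (simp add: norm_vector_smult)
    also have "\<dots> \<le> s / R * R"
      using that R s by (intro mult_left_mono) auto
    finally have "A w \<in> cball a s"
      using R by (simp add: A_def dist_norm)
    then show ?thesis
      using s by blast
  qed
  \<comment> \<open>\<open>f\<close> composed with the inverse of \<open>A\<close>, cut down to a
    representative in \<open>hol \<Omega>\<close>.\<close>
  define F where "F = restr \<Omega> (\<lambda>w. f (- (vinverse b * a) + vinverse b * w))"
  have "F \<in> hol \<Omega>"
    unfolding F_def using runge_domain_open[OF assms] f by (intro restr_hol[of _ UNIV] hol_UNIV_affine) auto
  moreover have "compact (A ` K)"
    unfolding A_def using K by (intro compact_continuous_image continuous_intros)
  ultimately obtain p where p: "polynomial_fun p" "\<And>z. z \<in> A ` K \<Longrightarrow> dist (p z) (F z) < e"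
    using runge_domain_approx[OF assms, of F "A ` K" e] A e by blast
  have "F (A w) = f w" if "w \<in> K" for w
  proof -
    have "- (vinverse b * a) + vinverse b * A w = w"
      using b by (simp add: A_def distrib_left)
    then show ?thesis
      using A[OF that] by (simp add: F_def restr_def)
  qed
  then have "\<forall>z\<in>K. dist (p (A z)) (f z) < e"
    using p(2) by fastforce
  moreover have "polynomial_fun (\<lambda>z. p (A z))"
    unfolding A_def using p(1) by (rule polynomial_fun_affine)
  ultimately show "\<exists>p. polynomial_fun p \<and> (\<forall>z\<in>K. dist (p z) (f z) < e)"
    by blast
qed auto

text \<open>Undilation carries \<open>f\<close> and \<open>K\<close> to \<open>\<Omega>\<close>, and
  the polynomial found there stays a polynomial when dilated back.\<close>

lemma runge_domain_inv_dilate: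
  assumes "runge_domain \<Omega>" "z \<notin> zero_coord"
  shows "runge_domain (inv_dilate z \<Omega>)"
  unfolding runge_domain_def
proof (intro conjI ballI allI impI; (elim conjE)?)
  show "open (inv_dilate z \<Omega>)"
    using assms by (intro open_inv_dilate runge_domain_open)
  show "connected (inv_dilate z \<Omega>)"
    unfolding inv_dilate_def using assms
    by (intro connected_continuous_image continuous_intros) (auto simp: runge_domain_def)
  show "inv_dilate z \<Omega> \<noteq> {}"
    using assms by (auto simp: inv_dilate_def runge_domain_def)
  fix f K e
  assume f: "f \<in> hol (inv_dilate z \<Omega>)" and K: "compact K" "K \<subseteq> inv_dilate z \<Omega>" and e: "(e :: real) > 0"
  have "compact ((\<lambda>w. z * w) ` K)" "(\<lambda>w. z * w) ` K \<subseteq> \<Omega>"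
    using K assms by (auto intro!: compact_continuous_image continuous_intros simp: inv_dilate_eq)
  then obtain p where p: "polynomial_fun p"
    "\<And>w. w \<in> (\<lambda>w. z * w) ` K \<Longrightarrow> dist (p w) (f (vinverse z * w)) < e"
    using runge_domain_approx[OF assms(1) hol_undilate[OF f assms(2)]] e by metis
  have "\<forall>w\<in>K. dist (p (0 + z * w)) (f w) < e"
    using p(2) assms(2) by fastforce
  then show "\<exists>p. polynomial_fun p \<and> (\<forall>w\<in>K. dist (p w) (f w) < e)"
    using polynomial_fun_affine[OF p(1)] by blast
qed

text \<open>Polynomial number \<open>n\<close> is \<open>1 / Suc n\<close>-close to \<open>f\<close>
  on member \<open>n\<close> of a compact exhaustion. That one sequence serves all compact sets
  matters, since limits built from it must not depend on \<open>K\<close>.\<close>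

lemma runge_domain_sequence:
  fixes \<Omega> :: "(complex ^ 'n) set"
  assumes "runge_domain \<Omega>" "f \<in> hol \<Omega>"
  obtains p where "\<And>k. polynomial_fun (p k)"
    "\<And>K. compact K \<Longrightarrow> K \<subseteq> \<Omega> \<Longrightarrow> uniform_limit K p f sequentially"
proof -
  have "\<exists>C :: nat \<Rightarrow> _. (\<forall>n. compact (C n)) \<and> (\<forall>n. C n \<subseteq> \<Omega>) \<and>
      (\<forall>K. compact K \<and> K \<subseteq> \<Omega> \<longrightarrow> (\<exists>N. \<forall>n\<ge>N. K \<subseteq> C n))"
  proof (rule open_Union_compact_subsets[OF runge_domain_open[OF assms(1)]])
    fix C :: "nat \<Rightarrow> (complex ^ 'n) set"
    assume "\<And>n. compact (C n)" "\<And>n. C n \<subseteq> \<Omega>"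
      "\<And>K. \<lbrakk>compact K; K \<subseteq> \<Omega>\<rbrakk> \<Longrightarrow> \<exists>N. \<forall>n\<ge>N. K \<subseteq> C n"
    then show ?thesis
      by (intro exI[of _ C]) simp
  qed
  then obtain C :: "nat \<Rightarrow> _" where C0: "\<forall>n. compact (C n)" "\<forall>n. C n \<subseteq> \<Omega>"
    "\<forall>K. compact K \<and> K \<subseteq> \<Omega> \<longrightarrow> (\<exists>N. \<forall>n\<ge>N. K \<subseteq> C n)"
    by (elim exE conjE)
  note C = C0[rule_format]
  have "\<exists>p. polynomial_fun p \<and> (\<forall>z\<in>C n. dist (p z) (f z) < 1 / Suc n)" for n
    by (rule runge_domain_approx[OF assms C(1)[of n] C(2)[of n], of "1 / real (Suc n)"]) auto
  then obtain p where p: "\<And>n. polynomial_fun (p n)" "\<And>n z. z \<in> C n \<Longrightarrow> dist (p n z) (f z) < 1 / Suc n"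
    by metis
  have "uniform_limit K p f sequentially" if K: "compact K" "K \<subseteq> \<Omega>" for K
    unfolding uniform_limit_iff
  proof (intro allI impI)
    fix e :: real assume "e > 0"
    then obtain M where M: "1 / Suc M < e"
      using nat_approx_posE by blast
    obtain N where N: "\<forall>n\<ge>N. K \<subseteq> C n"
      using C(3)[of K] K by blast
    have "dist (p n z) (f z) < e" if "n \<ge> max M N" "z \<in> K" for n z
    proof -
      have "dist (p n z) (f z) < 1 / Suc n"
        using p(2) N that by auto
      also have "\<dots> \<le> 1 / Suc M"
        using that by (simp add: field_simps)
      finally show ?thesis
        using M by linarith
    qed
    then show "\<forall>\<^sub>F n in sequentially. \<forall>x\<in>K. dist (p n x) (f x) < e"
      unfolding eventually_sequentially by blast
  qed
  then show ?thesis
    using that p(1) by blast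
qed

section \<open>Continuous functionals\<close>

abbreviation lin_functional :: "(complex ^ 'n) set \<Rightarrow> ((complex ^ 'n \<Rightarrow> complex) \<Rightarrow> complex) \<Rightarrow> bool" where
  "lin_functional \<Omega> \<equiv> lin_on fscale (*) (hol \<Omega>)"

text \<open>
  This is \<open>|T f| \<le> C sup\<^sub>K |f|\<close>. Quantifying over upper bounds \<open>B \<ge> 0\<close> instead of taking the
  supremum gives \<open>K = {}\<close> the right meaning \<open>T = 0\<close>.
\<close>

definition dominated ::
  "(complex ^ 'n \<Rightarrow> complex) set \<Rightarrow> (complex ^ 'n) set \<Rightarrow> real \<Rightarrow> ((complex ^ 'n \<Rightarrow> complex) \<Rightarrow> complex) \<Rightarrow> bool" where
  "dominated H K C T \<longleftrightarrow>
     (\<forall>f\<in>H. \<forall>B\<ge>0. (\<forall>z\<in>K. cmod (f z) \<le> B) \<longrightarrow> cmod (T f) \<le> C * B)"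

lemma hol_diff: "f \<in> hol \<Omega> \<Longrightarrow> g \<in> hol \<Omega> \<Longrightarrow> (\<lambda>z. f z - g z) \<in> hol \<Omega>"
  using hol_add[OF _ hol_fscale[of g \<Omega> "-1"], of f] by (simp add: plus_fun_def fscale_def)

lemma lin_functional_diff:
  assumes "lin_functional \<Omega> T" "f \<in> hol \<Omega>" "g \<in> hol \<Omega>"
  shows "T (\<lambda>z. f z - g z) = T f - T g"
proof -
  have "T (f + fscale (-1) g) = T f + (-1) * T g"
    using assms hol_fscale unfolding lin_on_def by metis
  then show ?thesis
    by (simp add: plus_fun_def fscale_def)
qed

lemma lin_functional_zero:
  assumes "lin_functional \<Omega> T"
  shows "T 0 = 0"
proof -
  have "T (fscale 0 0) = 0 * T 0"
    using assms hol_zero unfolding lin_on_def by blast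
  then show ?thesis
    by (simp add: fscale_def zero_fun_def)
qed

lemma lin_functional_sum:
  assumes "lin_functional \<Omega> T" "\<And>i. i \<in> A \<Longrightarrow> f i \<in> hol \<Omega>"
  shows "T (\<lambda>w. \<Sum>i\<in>A. c i * f i w) = (\<Sum>i\<in>A. c i * T (f i))"
  using assms(2)
proof (induction A rule: infinite_finite_induct)
  case (insert i A)
  have "(\<lambda>w. \<Sum>j\<in>insert i A. c j * f j w) = fscale (c i) (f i) + (\<lambda>w. \<Sum>j\<in>A. c j * f j w)"
    using insert.hyps by (simp add: fscale_def plus_fun_def)
  moreover have "T \<dots> = T (fscale (c i) (f i)) + T (\<lambda>w. \<Sum>j\<in>A. c j * f j w)"
  proof -
    have "fscale (c i) (f i) \<in> hol \<Omega>" "(\<lambda>w. \<Sum>j\<in>A. c j * f j w) \<in> hol \<Omega>"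
      using insert.prems by (auto intro!: hol_fscale hol_sum)
    then show ?thesis
      using assms(1) unfolding lin_on_def by blast
  qed
  moreover have "T (fscale (c i) (f i)) = c i * T (f i)"
    using assms(1) insert.prems unfolding lin_on_def by blast
  ultimately show ?case
    using insert by simp
qed (use lin_functional_zero[OF assms(1)] in \<open>simp_all add: zero_fun_def\<close>)

text \<open>Two sequences are compared, rather than a sequence and its limit, because the common
  limit may lie outside the domain of a functional that is still to be extended.\<close>

lemma dominated_tendsto_diff:
  assumes T: "lin_functional \<Omega> T" "dominated (hol \<Omega>) K C T" "C \<ge> 0"
    and f: "\<And>k. f k \<in> hol \<Omega>" and "\<And>k. g k \<in> hol \<Omega>" and lim: "uniform_limit K (\<lambda>k z. f k z - g k z) (\<lambda>z. 0) F"
  shows "((\<lambda>k. T (f k) - T (g k)) \<longlongrightarrow> 0) F"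
proof (rule tendstoI)
  fix e :: real assume "e > 0"
  \<comment> \<open>Dividing by \<open>C + 1\<close> allows \<open>C = 0\<close> and leaves
    \<open>C * d\<close> strictly below \<open>e\<close>.\<close>
  define d where "d = e / (C + 1)"
  have d: "d > 0" "C * d < e"
    using T(3) \<open>e > 0\<close> by (auto simp: d_def field_simps)
  then have "\<forall>\<^sub>F k in F. \<forall>z\<in>K. dist (f k z - g k z) 0 < d"
    using lim unfolding uniform_limit_iff by blast
  then show "\<forall>\<^sub>F k in F. dist (T (f k) - T (g k)) 0 < e"
  proof eventually_elim
    case (elim k)
    have "cmod (T (\<lambda>z. f k z - g k z)) \<le> C * d"
      using T(2) elim d(1) hol_diff[OF assms(4,5), of k k]
      unfolding dominated_def by (auto simp: less_imp_le)
    then show ?case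
      using d(2) lin_functional_diff[OF T(1) assms(4,5)] by simp
  qed
qed

lemma dominated_tendsto:
  assumes T: "lin_functional \<Omega> T" "dominated (hol \<Omega>) K C T" "C \<ge> 0"
    and "\<And>k. f k \<in> hol \<Omega>" "g \<in> hol \<Omega>" and lim: "uniform_limit K f g F"
  shows "((\<lambda>k. T (f k)) \<longlongrightarrow> T g) F"
proof -
  have "((\<lambda>k. T (f k) - T ((\<lambda>_. g) k)) \<longlongrightarrow> 0) F"
  proof (rule dominated_tendsto_diff[OF T])
    show "uniform_limit K (\<lambda>k z. f k z - g z) (\<lambda>z. 0) F"
      using lim by (simp add: uniform_limit_iff dist_norm)
  qed (use assms in auto)
  then show ?thesis
    by (simp add: LIM_zero_iff)
qed

text \<open>Homogeneity: a function bounded by \<open>B\<close> on \<open>K\<close> is scaled by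
  \<open>e / (2 * B)\<close> to fall strictly below \<open>e\<close> there, whence the 2 in the
  constant.\<close>

lemma dominatedI_unit:
  fixes \<Omega> :: "(complex ^ 'n) set"
  assumes T: "lin_functional \<Omega> T" and e: "e > 0"
    and K: "\<And>g. g \<in> hol \<Omega> \<Longrightarrow> \<forall>z\<in>K. cmod (g z) < e \<Longrightarrow> cmod (T g) < 1"
  shows "dominated (hol \<Omega>) K (2 / e) T"
proof -
  have pos: "cmod (T f) \<le> 2 / e * B" if f: "f \<in> hol \<Omega>" and B: "B > 0" "\<forall>z\<in>K. cmod (f z) \<le> B" for f B
  proof -
    define c where "c = complex_of_real (e / (2 * B))"
    have c: "cmod c = e / (2 * B)"
      using B e by (simp add: c_def norm_divide)
    have "cmod (fscale c f z) < e" if "z \<in> K" for z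
    proof -
      have "cmod (fscale c f z) \<le> e / (2 * B) * B"
        unfolding fscale_def norm_mult c using B e that by (intro mult_left_mono) auto
      also have "\<dots> < e"
        using B e by simp
      finally show ?thesis .
    qed
    then have "cmod (T (fscale c f)) < 1"
      using K hol_fscale[OF f] by blast
    moreover have "T (fscale c f) = c * T f"
      using T f unfolding lin_on_def by blast
    ultimately have "e / (2 * B) * cmod (T f) < 1"
      by (simp add: norm_mult c)
    then show ?thesis
      using B e by (simp add: field_simps)
  qed
  \<comment> \<open>The scaling excludes \<open>B = 0\<close>, which is reached as a limit:
    replacing \<open>B\<close> by \<open>B + d * e / 2\<close> costs exactly
    \<open>d\<close>.\<close>
  have "cmod (T f) \<le> 2 / e * B" if f: "f \<in> hol \<Omega>" and B: "B \<ge> 0" "\<forall>z\<in>K. cmod (f z) \<le> B" for f B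
  proof (rule field_le_epsilon)
    fix d :: real assume d: "d > 0"
    have "cmod (T f) \<le> 2 / e * (B + d * e / 2)"
      using B d e by (intro pos f) (auto intro: add_nonneg_pos add_increasing2)
    then show "cmod (T f) \<le> 2 / e * B + d"
      using e by (simp add: field_simps)
  qed
  then show ?thesis
    unfolding dominated_def by blast
qed

text \<open>The preimage of the unit disc is a neighbourhood of 0, so it contains all functions
  small on some compact set; scaling does the rest. With the converse below, continuity may be
  handled through bounds.\<close>

lemma continuous_dominated:
  fixes \<Omega> :: "(complex ^ 'n) set"
  assumes T: "lin_functional \<Omega> T" and cont: "continuous_map (hol_top \<Omega>) euclidean T"
  obtains K C where "compact K" "K \<subseteq> \<Omega>" "C \<ge> 0" "dominated (hol \<Omega>) K C T"
proof -
  have "openin (hol_top \<Omega>) {f \<in> topspace (hol_top \<Omega>). T f \<in> ball 0 1}"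
    using cont by (rule openin_continuous_map_preimage) simp
  then have op: "hol_open \<Omega> {f \<in> hol \<Omega>. T f \<in> ball 0 1}"
    by (simp add: openin_hol_top topspace_hol_top)
  have zero: "0 \<in> {f \<in> hol \<Omega>. T f \<in> ball 0 1}"
    using hol_zero lin_functional_zero[OF T] by auto
  obtain K e where K: "compact K" "K \<subseteq> \<Omega>" "e > 0"
    "{g \<in> hol \<Omega>. \<forall>z\<in>K. dist (g z) ((0 :: complex ^ 'n \<Rightarrow> complex) z) < e} \<subseteq> {f \<in> hol \<Omega>. T f \<in> ball 0 1}"
    using op zero unfolding hol_open_def by blast
  have "dominated (hol \<Omega>) K (2 / e) T"
  proof (rule dominatedI_unit[OF T K(3)])
    fix g assume "g \<in> hol \<Omega>" "\<forall>z\<in>K. cmod (g z) < e"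
    then show "cmod (T g) < 1"
      using K(4) by (auto simp: subset_iff)
  qed
  then show ?thesis
    using that[of K "2 / e"] K by simp
qed

lemma dominated_continuous:
  fixes \<Omega> :: "(complex ^ 'n) set"
  assumes T: "lin_functional \<Omega> T" "dominated (hol \<Omega>) K C T" "C \<ge> 0" and K: "compact K" "K \<subseteq> \<Omega>"
  shows "continuous_map (hol_top \<Omega>) euclidean T"
  unfolding continuous_map_def
proof (intro conjI allI impI)
  show "T \<in> topspace (hol_top \<Omega>) \<rightarrow> topspace euclidean"
    by simp
  fix U :: "complex set" assume "openin euclidean U"
  then have U: "open U"
    by simp
  have "hol_open \<Omega> {f \<in> hol \<Omega>. T f \<in> U}"
    unfolding hol_open_def
  proof (intro conjI ballI)
    fix f assume f: "f \<in> {f \<in> hol \<Omega>. T f \<in> U}"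
    then have "T f \<in> U"
      by blast
    then obtain e where e: "e > 0" "ball (T f) e \<subseteq> U"
      using U open_contains_ball by blast
    define d where "d = e / (C + 1)"
    have d: "d > 0" "C * d < e"
      using e T(3) by (auto simp: d_def field_simps)
    have "T g \<in> U" if g: "g \<in> hol \<Omega>" "\<forall>z\<in>K. dist (g z) (f z) < d" for g
    proof -
      have "cmod (T (\<lambda>z. g z - f z)) \<le> C * d"
        using T(2) g d(1) f hol_diff[of g \<Omega> f] unfolding dominated_def by (auto simp: dist_norm less_imp_le)
      then have "dist (T f) (T g) < e"
        using lin_functional_diff[OF T(1) g(1), of f] f d(2) by (simp add: dist_norm norm_minus_commute)
      then show ?thesis
        using e by auto
    qed
    then show "\<exists>K e. compact K \<and> K \<subseteq> \<Omega> \<and> e > 0 \<and>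
        {g \<in> hol \<Omega>. \<forall>z\<in>K. dist (g z) (f z) < e} \<subseteq> {f \<in> hol \<Omega>. T f \<in> U}"
      using K d(1) by blast
  qed auto
  then show "openin (hol_top \<Omega>) {f \<in> topspace (hol_top \<Omega>). T f \<in> U}"
    by (simp add: openin_hol_top topspace_hol_top)
qed

section \<open>The dual space and its determination by moments\<close>

lemma hol_dual_lin: "T \<in> hol_dual \<Omega> \<Longrightarrow> lin_functional \<Omega> T"
  by (simp add: hol_dual_def)

lemma hol_dual_outside: "T \<in> hol_dual \<Omega> \<Longrightarrow> f \<notin> hol \<Omega> \<Longrightarrow> T f = 0"
  by (simp add: hol_dual_def)

lemma hol_dual_dominated:
  assumes "T \<in> hol_dual \<Omega>"
  obtains K C where "compact K" "K \<subseteq> \<Omega>" "C \<ge> 0" "dominated (hol \<Omega>) K C T"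
proof (rule continuous_dominated[of \<Omega> T])
  show "lin_functional \<Omega> T" "continuous_map (hol_top \<Omega>) euclidean T"
    using assms by (auto simp: hol_dual_def)
qed (rule that)

lemma hol_dualI:
  assumes "lin_functional \<Omega> T" "dominated (hol \<Omega>) K C T" "C \<ge> 0" "compact K" "K \<subseteq> \<Omega>"
    "\<And>f. f \<notin> hol \<Omega> \<Longrightarrow> T f = 0"
  shows "T \<in> hol_dual \<Omega>"
  using assms dominated_continuous[OF assms(1-5)] by (simp add: hol_dual_def)

lemma restr_UNIV [simp]: "restr UNIV f = f"
  by (simp add: restr_def)

lemma lin_functional_polynomial:
  assumes "lin_functional \<Omega> T" "open \<Omega>"
  shows "T (restr \<Omega> (\<lambda>z. \<Sum>\<alpha>\<in>A. c \<alpha> * monomial \<alpha> z)) = (\<Sum>\<alpha>\<in>A. c \<alpha> * T (restr \<Omega> (monomial \<alpha>)))"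
proof -
  have "restr \<Omega> (\<lambda>z. \<Sum>\<alpha>\<in>A. c \<alpha> * monomial \<alpha> z) = (\<lambda>z. \<Sum>\<alpha>\<in>A. c \<alpha> * restr \<Omega> (monomial \<alpha>) z)"
    by (auto simp: restr_def)
  then show ?thesis
    using lin_functional_sum[OF assms(1), of A "\<lambda>\<alpha>. restr \<Omega> (monomial \<alpha>)" c]
      restr_hol[OF monomial_hol assms(2)] by simp
qed

text \<open>Linearity gives equality on polynomials. It survives the limit because one polynomial
  sequence converges on the compact sets of both bounds.\<close>

lemma hol_dual_eqI_moments:
  assumes "runge_domain \<Omega>" "S \<in> hol_dual \<Omega>" "S' \<in> hol_dual \<Omega>"
    and eq: "\<And>\<alpha>. S (restr \<Omega> (monomial \<alpha>)) = S' (restr \<Omega> (monomial \<alpha>))"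
  shows "S = S'"
proof
  fix f
  note op = runge_domain_open[OF assms(1)]
  show "S f = S' f"
  proof (cases "f \<in> hol \<Omega>")
    case True
    obtain p where p: "\<And>k. polynomial_fun (p k)"
      "\<And>K. compact K \<Longrightarrow> K \<subseteq> \<Omega> \<Longrightarrow> uniform_limit K p f sequentially"
      using runge_domain_sequence[OF assms(1) True] by blast
    have hol: "restr \<Omega> (p k) \<in> hol \<Omega>" for k
      using restr_hol[OF polynomial_fun_hol[OF p(1)] op] by simp
    have "S (restr \<Omega> (p k)) = S' (restr \<Omega> (p k))" for k
    proof -
      obtain A c where A: "p k = (\<lambda>z. \<Sum>\<alpha>\<in>A. c \<alpha> * monomial \<alpha> z)"
        using p(1) unfolding polynomial_fun_def by blast
      show ?thesis
        unfolding A by (simp add: lin_functional_polynomial[OF hol_dual_lin op] assms(2,3) eq)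
    qed
    moreover have lim: "(\<lambda>k. R (restr \<Omega> (p k))) \<longlonglongrightarrow> R f" if R: "R \<in> hol_dual \<Omega>" for R
    proof -
      obtain K C where K: "compact K" "K \<subseteq> \<Omega>" "C \<ge> 0" "dominated (hol \<Omega>) K C R"
        using hol_dual_dominated[OF R] .
      have "uniform_limit K (\<lambda>k. restr \<Omega> (p k)) f sequentially \<longleftrightarrow> uniform_limit K p f sequentially"
        using K(2) by (intro uniform_limit_cong') (auto simp: restr_def)
      then show ?thesis
        using dominated_tendsto[OF hol_dual_lin[OF R] K(4,3) hol True] p(2)[OF K(1,2)] by simp
    qed
    ultimately show ?thesis
      using lim[OF assms(2)] lim[OF assms(3)] LIMSEQ_unique by simp
  qed (use assms in \<open>simp add: hol_dual_outside\<close>)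
qed

text \<open>A carrier yields bounds over open neighbourhoods. Squeezing a compact \<open>L\<close>
  between a neighbourhood of \<open>K\<close> and \<open>U\<close> turns them into a bound on a
  compact set, at the price of enlarging \<open>K\<close>.\<close>

lemma carrier_of_dominated:
  assumes "carrier_of K T" "K \<subseteq> U" "open U"
  obtains L C where "compact L" "L \<subseteq> U" "C \<ge> 0" "dominated (hol UNIV) L C T"
proof -
  have K: "compact K"
    using assms by (simp add: carrier_of_def)
  obtain e where e: "e > 0" "(\<Union>x\<in>K. ball x e) \<subseteq> U"
    using compact_subset_open_imp_ball_epsilon_subset[OF K assms(3,2)] .
  \<comment> \<open>The closed \<open>e / 2\<close>-neighbourhood of \<open>K\<close>, written as a
    sum of compact sets to make its compactness immediate; half of \<open>e\<close> keeps it inside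
    \<open>U\<close>.\<close>
  define L where "L = {x + y |x y. x \<in> K \<and> y \<in> cball 0 (e / 2)}"
  define V where "V = (\<Union>x\<in>K. ball x (e / 2))"
  have L: "compact L"
    unfolding L_def using K by (intro compact_sums compact_cball)
  have "L \<subseteq> (\<Union>x\<in>K. ball x e)"
    using e(1) by (auto simp: L_def dist_norm intro!: bexI)
  then have LU: "L \<subseteq> U"
    using e(2) by blast
  have VL: "V \<subseteq> L"
  proof
    fix y assume "y \<in> V"
    then obtain x where "x \<in> K" "dist x y < e / 2"
      by (auto simp: V_def)
    then show "y \<in> L"
      unfolding L_def
      by (intro CollectI exI[of _ x] exI[of _ "y - x"]) (simp add: dist_norm norm_minus_commute)
  qed
  have "open V" "K \<subseteq> V"
    using e(1) by (auto simp: V_def)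
  then have "\<exists>C::real. \<forall>f\<in>hol UNIV.
      ennreal (cmod (T f)) \<le> ennreal C * (SUP z\<in>V. ennreal (cmod (f z)))"
    using assms(1)[unfolded carrier_of_def, THEN conjunct2, THEN spec[of _ V]] by simp
  then obtain C :: real where C: "\<And>f. f \<in> hol UNIV \<Longrightarrow>
      ennreal (cmod (T f)) \<le> ennreal C * (SUP z\<in>V. ennreal (cmod (f z)))"
    by blast
  \<comment> \<open>\<open>C\<close> may be negative; \<open>ennreal\<close> already sends such a
    constant to 0.\<close>
  have "dominated (hol UNIV) L (max C 0) T"
    unfolding dominated_def
  proof (intro ballI allI impI)
    fix f B assume f: "f \<in> hol UNIV" and B: "B \<ge> 0" "\<forall>z\<in>L. cmod (f z) \<le> B"
    have "(SUP z\<in>V. ennreal (cmod (f z))) \<le> ennreal B"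
      using B VL by (intro SUP_least ennreal_leI) auto
    then have "ennreal (cmod (T f)) \<le> ennreal (max C 0) * ennreal B"
      using C[OF f] by (smt (verit) ennreal_leI max.cobounded1 mult_mono order_trans zero_le)
    also have "\<dots> = ennreal (max C 0 * B)"
      using B by (simp add: ennreal_mult)
    finally show "cmod (T f) \<le> max C 0 * B"
      using B by (simp add: ennreal_le_iff)
  qed
  then show ?thesis
    by (intro that[OF L LU]) auto
qed

lemma dominated_carrier_of:
  assumes "compact K" "C \<ge> 0" "dominated (hol UNIV) K C T"
  shows "carrier_of K T"
  unfolding carrier_of_def
proof (intro conjI allI impI assms(1) exI ballI; elim conjE)
  fix V f assume V: "open V" "K \<subseteq> V" and f: "f \<in> hol (UNIV :: (complex ^ 'a) set)"
  \<comment> \<open>\<open>0 * top = 0\<close> in \<open>ennreal\<close>; adding 1 makes the factor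
    nonzero, so that the right side is infinite when \<open>f\<close> is unbounded on
    \<open>V\<close>.\<close>
  show "ennreal (cmod (T f)) \<le> ennreal (C + 1) * (SUP z\<in>V. ennreal (cmod (f z)))"
  proof (cases "(SUP z\<in>V. ennreal (cmod (f z))) = top")
    case True
    show ?thesis
      unfolding True using assms(2) by (simp add: ennreal_mult_top)
  next
    case False
    define B where "B = enn2real (SUP z\<in>V. ennreal (cmod (f z)))"
    have B: "ennreal B = (SUP z\<in>V. ennreal (cmod (f z)))"
      unfolding B_def using False by (intro ennreal_enn2real) (simp only: less_top)
    have "ennreal (cmod (f z)) \<le> ennreal B" if "z \<in> K" for z
      unfolding B using that V by (intro SUP_upper) auto
    moreover have B0: "B \<ge> 0"
      by (simp add: B_def)
    ultimately have "cmod (T f) \<le> C * B"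
      using assms(3) f unfolding dominated_def by simp
    also have "\<dots> \<le> (C + 1) * B"
      using B0 by (simp add: algebra_simps)
    finally have "ennreal (cmod (T f)) \<le> ennreal ((C + 1) * B)"
      by (rule ennreal_leI)
    then show ?thesis
      using assms(2) B0 by (simp add: ennreal_mult B)
  qed
qed

section \<open>Bounds shared by families of functionals, and their limits\<close>

lemma dominatedD:
  "dominated H K C T \<Longrightarrow> f \<in> H \<Longrightarrow> B \<ge> 0 \<Longrightarrow> (\<And>z. z \<in> K \<Longrightarrow> cmod (f z) \<le> B) \<Longrightarrow> cmod (T f) \<le> C * B"
  unfolding dominated_def by blast

lemma dominated_mono:
  assumes "dominated H K C T" "K \<subseteq> L" "C \<le> D"
  shows "dominated H L D T"
  unfolding dominated_def
proof (intro ballI allI impI)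
  fix f and B :: real
  assume "f \<in> H" "0 \<le> B" "\<forall>z\<in>L. cmod (f z) \<le> B"
  then have "cmod (T f) \<le> C * B"
    using assms(2) by (intro dominatedD[OF assms(1)]) auto
  also have "\<dots> \<le> D * B"
    using assms(3) \<open>0 \<le> B\<close> by (rule mult_right_mono)
  finally show "cmod (T f) \<le> D * B" .
qed

lemma dominated_add:
  assumes "dominated H K C S" "dominated H L D T"
  shows "dominated H (K \<union> L) (C + D) (\<lambda>f. S f + T f)"
  unfolding dominated_def
proof (intro ballI allI impI)
  fix f and B :: real
  assume f: "f \<in> H" "0 \<le> B" "\<forall>z\<in>K \<union> L. cmod (f z) \<le> B"
  have "cmod (S f) \<le> C * B" "cmod (T f) \<le> D * B"
    using f by (auto intro!: dominatedD[OF assms(1)] dominatedD[OF assms(2)])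
  then show "cmod (S f + T f) \<le> (C + D) * B"
    using norm_triangle_ineq[of "S f" "T f"] by (simp add: distrib_right)
qed

lemma dominated_scale:
  assumes "dominated H K C T"
  shows "dominated H K (cmod c * C) (\<lambda>f. c * T f)"
  unfolding dominated_def
proof (intro ballI allI impI)
  fix f and B :: real
  assume f: "f \<in> H" "0 \<le> B" "\<forall>z\<in>K. cmod (f z) \<le> B"
  then have "cmod (T f) \<le> C * B"
    by (intro dominatedD[OF assms]) auto
  then show "cmod (c * T f) \<le> cmod c * C * B"
    by (simp add: norm_mult mult_left_mono mult.assoc)
qed

lemma dominated_zero: "dominated H {} 0 (\<lambda>f. 0)"
  by (simp add: dominated_def)

text \<open>Finite subcover: the union of finitely many compact sets together with the sum of their
  constants is weaker than each local bound.\<close>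

lemma dominated_compact:
  fixes X :: "'b :: metric_space set" and \<Omega> :: "(complex ^ 'n) set"
  assumes X: "compact X"
    and loc: "\<And>x. x \<in> X \<Longrightarrow> \<exists>e>0. \<exists>Q C. compact Q \<and> Q \<subseteq> \<Omega> \<and> C \<ge> 0 \<and> (\<forall>y\<in>ball x e. dominated H Q C (T y))"
  shows "\<exists>Q C. compact Q \<and> Q \<subseteq> \<Omega> \<and> C \<ge> 0 \<and> (\<forall>y\<in>X. dominated H Q C (T y))"
proof -
  have "\<forall>x\<in>X. \<exists>e Q C. e > 0 \<and> compact Q \<and> Q \<subseteq> \<Omega> \<and> C \<ge> 0 \<and> (\<forall>y\<in>ball x e. dominated H Q C (T y))"
    using loc by blast
  then obtain e Q C where P: "\<forall>x\<in>X. e x > 0 \<and> compact (Q x) \<and> Q x \<subseteq> \<Omega> \<and> C x \<ge> 0 \<and>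
      (\<forall>y\<in>ball x (e x). dominated H (Q x) (C x) (T y))"
    by (simp only: bchoice_iff) (elim exE)
  have "X \<subseteq> (\<Union>x\<in>X. ball x (e x))"
    using P by auto
  then obtain I where I: "I \<subseteq> X" "finite I" "X \<subseteq> (\<Union>x\<in>I. ball x (e x))"
    using compactE_image[OF X, of X "\<lambda>x. ball x (e x)"] by blast
  show ?thesis
  proof (intro exI[of _ "\<Union>x\<in>I. Q x"] exI[of _ "\<Sum>x\<in>I. C x"] conjI ballI)
    show "compact (\<Union>x\<in>I. Q x)" "(\<Union>x\<in>I. Q x) \<subseteq> \<Omega>" "(\<Sum>x\<in>I. C x) \<ge> 0"
      using P I by (auto intro!: sum_nonneg simp: subset_iff)
    fix y assume "y \<in> X"
    then obtain x where x: "x \<in> I" "y \<in> ball x (e x)"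
      using I by blast
    show "dominated H (\<Union>x\<in>I. Q x) (\<Sum>x\<in>I. C x) (T y)"
    proof (rule dominated_mono)
      show "dominated H (Q x) (C x) (T y)"
        using P I x by blast
      show "C x \<le> (\<Sum>x\<in>I. C x)"
        using P I x by (intro member_le_sum) auto
    qed (use x in auto)
  qed
qed

text \<open>One pair \<open>K\<close>, \<open>C\<close> for all \<open>x\<close> makes the Cauchy
  property uniform in \<open>x\<close>. The class \<open>H\<close> is a parameter because the bounds
  are available on entire functions in one application and on polynomials in another.\<close>

lemma dominated_uniformly_Cauchy:
  assumes dom: "\<And>x. x \<in> X \<Longrightarrow> dominated H K C (T x)" and C: "C \<ge> 0"
    and diff: "\<And>x m k. x \<in> X \<Longrightarrow> T x (\<lambda>z. f m z - f k z) = T x (f m) - T x (f k)"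
    and H: "\<And>m k. (\<lambda>z. f m z - f k z) \<in> H" and lim: "uniform_limit K f g sequentially"
  shows "uniformly_Cauchy_on X (\<lambda>k x. T x (f k))"
  unfolding uniformly_Cauchy_on_def
proof (intro allI impI)
  fix e :: real assume e: "e > 0"
  define d where "d = e / (C + 1)"
  have d: "d > 0" "C * d < e"
    using e C by (auto simp: d_def field_simps)
  then have "\<forall>\<^sub>F k in sequentially. \<forall>z\<in>K. dist (f k z) (g z) < d / 2"
    using lim half_gt_zero unfolding uniform_limit_iff by blast
  then obtain N where N: "\<And>k z. k \<ge> N \<Longrightarrow> z \<in> K \<Longrightarrow> dist (f k z) (g z) < d / 2"
    unfolding eventually_sequentially by blast
  have "dist (T x (f m)) (T x (f k)) < e" if "x \<in> X" "m \<ge> N" "k \<ge> N" for x m k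
  proof -
    have "cmod (f m z - f k z) \<le> d" if "z \<in> K" for z
      using N[OF \<open>m \<ge> N\<close> that] N[OF \<open>k \<ge> N\<close> that] dist_triangle2[of "f m z" "f k z" "g z"]
      by (simp add: dist_norm)
    then have "cmod (T x (\<lambda>z. f m z - f k z)) \<le> C * d"
      using d(1) by (intro dominatedD[OF dom[OF that(1)] H]) auto
    then show ?thesis
      using d(2) diff[OF that(1), of m k] by (simp add: dist_norm)
  qed
  then show "\<exists>M. \<forall>x\<in>X. \<forall>m\<ge>M. \<forall>n\<ge>M. dist (T x (f m)) (T x (f n)) < e"
    by blast
qed

lemma le_mult_epsilon:
  fixes x B C :: real
  assumes "C \<ge> 0" "\<And>d. d > 0 \<Longrightarrow> x \<le> C * (B + d)"
  shows "x \<le> C * B"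
proof (rule field_le_epsilon)
  fix e :: real assume e: "e > 0"
  have "x \<le> C * (B + e / (C + 1))"
    using assms e by simp
  also have "\<dots> = C * B + C * (e / (C + 1))"
    by (simp add: distrib_left)
  also have "C * (e / (C + 1)) \<le> e"
    using assms(1) e by (simp add: field_simps)
  finally show "x \<le> C * B + e"
    by simp
qed

text \<open>\<open>g\<close> may lie outside \<open>H\<close>, so the bound for \<open>l\<close> is
  taken from those for \<open>f k\<close>, whose moduli on \<open>K\<close> are eventually at most
  \<open>B + d\<close>.\<close>

lemma dominated_limit_bound:
  assumes T: "dominated H K C T" "C \<ge> 0" and f: "\<And>k. f k \<in> H" "uniform_limit K f g sequentially"
    and l: "(\<lambda>k. T (f k)) \<longlonglongrightarrow> l" and B: "B \<ge> 0" "\<And>z. z \<in> K \<Longrightarrow> cmod (g z) \<le> B"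
  shows "cmod l \<le> C * B"
proof (rule le_mult_epsilon[OF T(2)])
  fix d :: real assume d: "d > 0"
  show "cmod l \<le> C * (B + d)"
  proof (rule tendsto_upperbound)
    show "(\<lambda>k. cmod (T (f k))) \<longlonglongrightarrow> cmod l"
      using l by (rule tendsto_norm)
    have "\<forall>\<^sub>F k in sequentially. \<forall>z\<in>K. dist (f k z) (g z) < d"
      using f(2) d unfolding uniform_limit_iff by simp
    then show "\<forall>\<^sub>F k in sequentially. cmod (T (f k)) \<le> C * (B + d)"
    proof eventually_elim
      case (elim k)
      have "cmod (f k z) \<le> B + d" if "z \<in> K" for z
        using elim[rule_format, OF that] B(2)[OF that] norm_triangle_sub[of "f k z" "g z"]
        by (simp add: dist_norm)
      then show ?case
        using B d by (intro dominatedD[OF T(1) f(1)]) auto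
    qed
  qed auto
qed

section \<open>Extension of analytic functionals\<close>

lemma extends_functional_unique:
  assumes "runge_domain U" "extends_functional U T S" "extends_functional U T S'"
  shows "S = S'"
  using assms by (intro hol_dual_eqI_moments[of U]) (auto simp: extends_functional_def monomial_hol)

text \<open>Extension by density. Approximation on the single set \<open>L\<close> suffices, since
  \<open>T\<close> is bounded by the supremum over \<open>L\<close>.\<close>

lemma extends_functional_exists:
  fixes U :: "(complex ^ 'n) set"
  assumes U: "runge_domain U" and T: "lin_functional UNIV T"
    and L: "compact L" "L \<subseteq> U" and C: "C \<ge> 0" "dominated (hol UNIV) L C T"
  shows "\<exists>S. extends_functional U T S"
proof -
  define approx where
    "approx = (\<lambda>f p. (\<forall>k. polynomial_fun (p k)) \<and> uniform_limit L p f sequentially)"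
  define P where "P = (\<lambda>f. SOME p. approx f p)"
  have P: "approx f (P f)" if f: "f \<in> hol U" for f
  proof -
    obtain p where "\<And>k. polynomial_fun (p k)"
      "\<And>K. compact K \<Longrightarrow> K \<subseteq> U \<Longrightarrow> uniform_limit K p f sequentially"
      using runge_domain_sequence[OF U f] by blast
    then have "\<exists>p. approx f p"
      unfolding approx_def using L by blast
    then show ?thesis
      unfolding P_def by (rule someI_ex)
  qed
  have hol: "p k \<in> hol UNIV" if "approx f p" for f p k
    using that polynomial_fun_hol by (auto simp: approx_def)
  define S where "S = (\<lambda>f. if f \<in> hol U then lim (\<lambda>k. T (P f k)) else 0)"
  have lim0: "(\<lambda>k. T (P f k)) \<longlonglongrightarrow> S f" if f: "f \<in> hol U" for f
  proof -
    \<comment> \<open>A one-point parameter set reduces the uniform statement to an ordinary Cauchy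
      sequence.\<close>
    have "uniformly_Cauchy_on {()} (\<lambda>k _. T (P f k))"
      using P[OF f] hol[OF P[OF f]] C
      by (intro dominated_uniformly_Cauchy[where K = L and g = f and H = "hol UNIV" and C = C and T = "\<lambda>_. T"])
         (auto simp: approx_def intro: hol_diff lin_functional_diff[OF T])
    then have "Cauchy (\<lambda>k. T (P f k))"
      by (intro uniformly_Cauchy_imp_Cauchy[where X = "{()}"]) auto
    then show ?thesis
      using f by (simp add: S_def Cauchy_convergent_iff convergent_LIMSEQ_iff)
  qed
  \<comment> \<open>Independence of the approximating sequence. Linearity rests on it, because
    \<open>P (f + g)\<close> is an arbitrary choice, not the sum of \<open>P f\<close> and
    \<open>P g\<close>.\<close>
  have lim: "(\<lambda>k. T (q k)) \<longlonglongrightarrow> S f" if f: "f \<in> hol U" and q: "approx f q" for f q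
  proof -
    have "uniform_limit L (\<lambda>k z. q k z - P f k z) (\<lambda>z. f z - f z) sequentially"
      using q P[OF f] by (intro uniform_limit_minus) (auto simp: approx_def)
    then have "(\<lambda>k. T (q k) - T (P f k)) \<longlonglongrightarrow> 0"
      using hol[OF q] hol[OF P[OF f]] by (intro dominated_tendsto_diff[OF T C(2,1)]) auto
    then show ?thesis
      using tendsto_add[OF _ lim0[OF f]] by fastforce
  qed
  have "S \<in> hol_dual U"
  proof (rule hol_dualI[OF _ _ C(1) L])
    show "lin_functional U S"
      unfolding lin_on_def
    proof (intro conjI ballI allI)
      fix f g assume f: "f \<in> hol U" and g: "g \<in> hol U"
      have "approx (f + g) (\<lambda>k z. P f k z + P g k z)"
        using P[OF f] P[OF g] unfolding approx_def plus_fun_def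
        by (auto intro!: polynomial_fun_add uniform_limit_add)
      then have "(\<lambda>k. T (\<lambda>z. P f k z + P g k z)) \<longlonglongrightarrow> S (f + g)"
        by (intro lim hol_add f g)
      moreover have "T (\<lambda>z. P f k z + P g k z) = T (P f k) + T (P g k)" for k
        using T hol[OF P[OF f], of k] hol[OF P[OF g], of k] unfolding lin_on_def plus_fun_def by blast
      ultimately show "S (f + g) = S f + S g"
        using tendsto_add[OF lim0[OF f] lim0[OF g]] LIMSEQ_unique by simp
    next
      fix c f assume f: "f \<in> hol U"
      have "uniform_limit L (\<lambda>k z. c * P f k z) (\<lambda>z. c * f z) sequentially"
        using P[OF f] by (intro bounded_linear.uniform_limit[OF bounded_linear_mult_right]) (simp add: approx_def)
      then have "approx (fscale c f) (\<lambda>k z. c * P f k z)"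
        using P[OF f] unfolding approx_def fscale_def
        by (auto intro!: polynomial_fun_mult polynomial_fun_const)
      then have "(\<lambda>k. T (\<lambda>z. c * P f k z)) \<longlonglongrightarrow> S (fscale c f)"
        by (intro lim hol_fscale f)
      moreover have "T (\<lambda>z. c * P f k z) = c * T (P f k)" for k
        using T hol[OF P[OF f], of k] unfolding lin_on_def fscale_def by blast
      ultimately show "S (fscale c f) = c * S f"
        using tendsto_mult_left[OF lim0[OF f], of c] LIMSEQ_unique by simp
    qed
    show "dominated (hol U) L C S"
      unfolding dominated_def
    proof (intro ballI allI impI)
      fix f B assume f: "f \<in> hol U" and B: "0 \<le> (B :: real)" "\<forall>z\<in>L. cmod (f z) \<le> B"
      show "cmod (S f) \<le> C * B"
        using P[OF f] hol[OF P[OF f]] B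
        by (intro dominated_limit_bound[OF C(2,1) _ _ lim0[OF f], of f]) (auto simp: approx_def)
    qed
    show "S f = 0" if "f \<notin> hol U" for f
      using that by (simp add: S_def)
  qed
  moreover have "S (restr U f) = T f" if f: "f \<in> hol UNIV" for f
  proof -
    have r: "restr U f \<in> hol U"
      using f runge_domain_open[OF U] by (intro restr_hol[of _ UNIV]) auto
    have "uniform_limit L (P (restr U f)) (restr U f) sequentially \<longleftrightarrow>
        uniform_limit L (P (restr U f)) f sequentially"
      using L(2) by (intro uniform_limit_cong') (auto simp: restr_def)
    then have "uniform_limit L (P (restr U f)) f sequentially"
      using P[OF r] by (simp add: approx_def)
    then have "(\<lambda>k. T (P (restr U f) k)) \<longlonglongrightarrow> T f"
      by (intro dominated_tendsto[OF T C(2,1)] hol[OF P[OF r]] f)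
    then show ?thesis
      using lim0[OF r] LIMSEQ_unique by blast
  qed
  ultimately show ?thesis
    unfolding extends_functional_def by blast
qed

text \<open>Carriers are traded for bounds on compact sets, which are easy to add, scale and
  transport; openness of the dilate leaves room for the enlargement.\<close>

lemma carried_functionals_iff:
  assumes "open \<Omega>"
  shows "T \<in> carried_functionals \<Omega> \<longleftrightarrow> T \<in> hol_dual UNIV \<and>
    (\<forall>z\<in>\<Omega> - zero_coord. \<exists>K C. compact K \<and> K \<subseteq> inv_dilate z \<Omega> \<and> C \<ge> 0 \<and> dominated (hol UNIV) K C T)"
proof -
  have "(\<exists>K. carrier_of K T \<and> K \<subseteq> inv_dilate z \<Omega>) \<longleftrightarrow>
      (\<exists>K C. compact K \<and> K \<subseteq> inv_dilate z \<Omega> \<and> C \<ge> 0 \<and> dominated (hol UNIV) K C T)"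
    if z: "z \<in> \<Omega> - zero_coord" for z
  proof
    assume "\<exists>K. carrier_of K T \<and> K \<subseteq> inv_dilate z \<Omega>"
    then obtain K where K: "carrier_of K T" "K \<subseteq> inv_dilate z \<Omega>"
      by blast
    have op: "open (inv_dilate z \<Omega>)"
      using assms z by (intro open_inv_dilate) auto
    show "\<exists>K C. compact K \<and> K \<subseteq> inv_dilate z \<Omega> \<and> C \<ge> 0 \<and> dominated (hol UNIV) K C T"
      by (rule carrier_of_dominated[OF K op]) blast
  qed (blast intro: dominated_carrier_of)
  then show ?thesis
    by (auto simp: carried_functionals_def)
qed

lemma functional_at_extends:
  assumes "runge_domain \<Omega>" "T \<in> carried_functionals \<Omega>" "z \<in> \<Omega> - zero_coord"
  shows "\<exists>!S. extends_functional (inv_dilate z \<Omega>) T S"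
    and "extends_functional (inv_dilate z \<Omega>) T (functional_at \<Omega> T z)"
proof -
  have U: "runge_domain (inv_dilate z \<Omega>)"
    using assms by (intro runge_domain_inv_dilate) auto
  have T: "T \<in> hol_dual UNIV"
    and "\<exists>K C. compact K \<and> K \<subseteq> inv_dilate z \<Omega> \<and> C \<ge> 0 \<and> dominated (hol UNIV) K C T"
    using assms(2,3) by (auto simp: carried_functionals_iff[OF runge_domain_open[OF assms(1)]])
  then obtain S where "extends_functional (inv_dilate z \<Omega>) T S"
    using extends_functional_exists[OF U hol_dual_lin[OF T]] by blast
  then show ex: "\<exists>!S. extends_functional (inv_dilate z \<Omega>) T S"
    using extends_functional_unique[OF U] by blast
  show "extends_functional (inv_dilate z \<Omega>) T (functional_at \<Omega> T z)"
    unfolding functional_at_def using ex by (rule theI')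
qed

lemma functional_at_eq:
  assumes "runge_domain \<Omega>" "z \<notin> zero_coord" "extends_functional (inv_dilate z \<Omega>) T S"
  shows "functional_at \<Omega> T z = S"
  unfolding functional_at_def
  using assms extends_functional_unique[OF runge_domain_inv_dilate[OF assms(1,2)]] by (intro the_equality) auto

section \<open>The multiplier of a carried functional\<close>

text \<open>\<open>T\<close> acts diagonally, multiplying the coefficient of each monomial by a
  moment, for every \<open>z\<close> including those with zero coordinates.\<close>

lemma polynomial_fun_dilate_functional:
  assumes T: "lin_functional UNIV T" and "polynomial_fun p"
  shows "polynomial_fun (\<lambda>z. T (\<lambda>w. p (z * w)))"
proof -
  obtain A c where A: "p = (\<lambda>z. \<Sum>\<alpha>\<in>A. c \<alpha> * monomial \<alpha> z)"
    using assms(2) by (auto simp: polynomial_fun_def)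
  have "T (\<lambda>w. p (z * w)) = (\<Sum>\<alpha>\<in>A. (c \<alpha> * monomial \<alpha> z) * T (monomial \<alpha>))" for z
    using lin_functional_sum[OF T, of A monomial "\<lambda>\<alpha>. c \<alpha> * monomial \<alpha> z"]
    by (simp add: A monomial_dilate monomial_hol mult.assoc)
  then have "(\<lambda>z. T (\<lambda>w. p (z * w))) = (\<lambda>z. \<Sum>\<alpha>\<in>A. (c \<alpha> * T (monomial \<alpha>)) * monomial \<alpha> z)"
    by (simp add: mult.assoc mult.commute mult.left_commute)
  then show ?thesis
    by (simp only:) (intro polynomial_fun_sum polynomial_fun_cmonomial)
qed

text \<open>The compact set \<open>L\<close> belonging to \<open>a\<close> is reused for all nearby
  \<open>z\<close>: the products \<open>z * w\<close> stay close to \<open>a * w\<close> and hence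
  in a compact subset of \<open>\<Omega>\<close>.\<close>

lemma carried_bound_off_zero_coord:
  fixes \<Omega> :: "(complex ^ 'n) set"
  assumes op: "open \<Omega>" and T: "T \<in> carried_functionals \<Omega>" and a: "a \<in> \<Omega> - zero_coord"
  shows "\<exists>e>0. \<exists>Q C. compact Q \<and> Q \<subseteq> \<Omega> \<and> C \<ge> 0 \<and>
    (\<forall>z\<in>ball a e. dominated (hol UNIV) Q C (\<lambda>f. T (\<lambda>w. f (z * w))))"
proof -
  obtain L C where L: "compact L" "L \<subseteq> inv_dilate a \<Omega>" "C \<ge> 0" "dominated (hol UNIV) L C T"
    using T a unfolding carried_functionals_iff[OF op] by blast
  have "compact ((\<lambda>w. a * w) ` L)" "(\<lambda>w. a * w) ` L \<subseteq> \<Omega>"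
    using L a by (auto intro!: compact_continuous_image continuous_intros simp: inv_dilate_eq)
  then obtain d where d: "d > 0" "(\<Union>x\<in>(\<lambda>w. a * w) ` L. ball x d) \<subseteq> \<Omega>"
    using compact_subset_open_imp_ball_epsilon_subset[OF _ op] by metis
  obtain R where R: "R > 0" "\<And>w. w \<in> L \<Longrightarrow> norm w \<le> R"
    using compact_imp_bounded[OF L(1)] bounded_pos by blast
  \<comment> \<open>Moving \<open>a\<close> by at most \<open>e\<close> moves \<open>a * w\<close>,
    for \<open>w\<close> in \<open>L\<close>, by at most \<open>e * R\<close>, which is half of
    \<open>d\<close>.\<close>
  define e where "e = d / (2 * R)"
  have e: "e > 0" "e * R < d"
    using d R by (auto simp: e_def)
  define Q where "Q = (\<lambda>x. fst x * snd x) ` (cball a e \<times> L)"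
  have "compact Q"
    unfolding Q_def using L(1) by (intro compact_continuous_image continuous_intros compact_Times) auto
  moreover have "Q \<subseteq> \<Omega>"
  proof
    fix x assume "x \<in> Q"
    then obtain z w where zw: "z \<in> cball a e" "w \<in> L" "x = z * w"
      by (auto simp: Q_def)
    have "dist (a * w) x = norm ((a - z) * w)"
      by (simp add: zw dist_norm algebra_simps)
    also have "\<dots> \<le> norm (a - z) * norm w"
      by (rule norm_vec_times_le)
    also have "\<dots> \<le> e * R"
      using zw R e by (intro mult_mono) (auto simp: dist_norm)
    finally have "x \<in> ball (a * w) d"
      using e(2) by simp
    then show "x \<in> \<Omega>"
      using d(2) zw(2) by blast
  qed
  moreover have "dominated (hol UNIV) Q C (\<lambda>f. T (\<lambda>w. f (z * w)))" if z: "z \<in> ball a e" for z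
    unfolding dominated_def
  proof (intro ballI allI impI)
    fix f B assume f: "f \<in> hol UNIV" and B: "0 \<le> (B :: real)" "\<forall>x\<in>Q. cmod (f x) \<le> B"
    show "cmod (T (\<lambda>w. f (z * w))) \<le> C * B"
    proof (rule dominatedD[OF L(4) _ B(1)])
      show "(\<lambda>w. f (z * w)) \<in> hol UNIV"
        using hol_UNIV_affine[OF f, of 0 z] by simp
      show "cmod (f (z * w)) \<le> B" if "w \<in> L" for w
        using B(2) that z by (force simp: Q_def)
    qed
  qed
  ultimately show ?thesis
    using e(1) L(3) by blast
qed

text \<open>
  For \<open>z\<close> near a point with zero coordinates, the circle \<open>z + t1\<close> of suitable radius
  stays in \<open>\<Omega>\<close> and avoids the zero coordinates, so the maximum modulus principle transports
  the bound from there.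
\<close>

lemma carried_bound_local:
  fixes \<Omega> :: "(complex ^ 'n) set"
  assumes op: "open \<Omega>" and T: "T \<in> carried_functionals \<Omega>" and a: "a \<in> \<Omega>"
  shows "\<exists>e>0. \<exists>Q C. compact Q \<and> Q \<subseteq> \<Omega> \<and> C \<ge> 0 \<and>
    (\<forall>z\<in>ball a e. dominated (Collect polynomial_fun) Q C (\<lambda>f. T (\<lambda>w. f (z * w))))"
proof -
  have lin: "lin_functional UNIV T"
    using T hol_dual_lin by (auto simp: carried_functionals_def)
  obtain s where s: "s > 0" "cball a s \<subseteq> \<Omega>"
    using op a open_contains_cball by blast
  \<comment> \<open>A parameter of modulus below \<open>\<rho>\<close> moves a point along the
    direction \<open>1\<close> by at most \<open>s / 2\<close>; the other half of \<open>s\<close>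
    is left for moving \<open>a\<close>.\<close>
  define \<rho> where "\<rho> = s / (2 * norm (1 :: complex ^ 'n))"
  have n1: "norm (1 :: complex ^ 'n) > 0"
    by (simp add: vec_eq_iff)
  then have "\<rho> > 0"
    using s by (simp add: \<rho>_def)
  \<comment> \<open>The circle \<open>a + t *s 1\<close> of radius \<open>r\<close> meets the zero
    coordinates only if \<open>r\<close> equals some \<open>cmod (a $ i)\<close>, so finitely many
    radii are excluded.\<close>
  then have "infinite ({0<..<\<rho>} - range (\<lambda>i. cmod (a $ i)))"
    by (simp add: infinite_Ioo)
  then obtain r where r: "r \<in> {0<..<\<rho>} - range (\<lambda>i. cmod (a $ i))"
    by (metis finite.emptyI ex_in_conv)
  then have r0: "0 < r" and rs: "r * norm (1 :: complex ^ 'n) \<le> s / 2"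
    using n1 by (auto simp: \<rho>_def field_simps)
  \<comment> \<open>The gap between \<open>r\<close> and the excluded radii: a centre closer than
    \<open>\<delta>\<close> to \<open>a\<close> has no coordinate of modulus
    \<open>r\<close>.\<close>
  define \<delta> where "\<delta> = Min (range (\<lambda>i. \<bar>cmod (a $ i) - r\<bar>))"
  have "\<delta> > 0"
    unfolding \<delta>_def using r by (subst Min_gr_iff) auto
  have \<delta>: "\<delta> \<le> \<bar>cmod (a $ i) - r\<bar>" for i
    unfolding \<delta>_def by (intro Min_le) auto
  define e where "e = min (s / 2) (\<delta> / 2)"
  have e: "e > 0" "e < \<delta>" "e \<le> s / 2"
    using s \<open>\<delta> > 0\<close> by (auto simp: e_def)
  define X where "X = (\<lambda>x. fst x + snd x *s 1) ` (cball a e \<times> sphere 0 r)"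
  have "continuous_on (cball a e \<times> sphere 0 r) (\<lambda>x. fst x + snd x *s (1 :: complex ^ 'n))"
    by (intro continuous_intros bounded_linear.continuous_on[OF bounded_linear_vector_smult])
  then have X: "compact X"
    unfolding X_def by (intro compact_continuous_image compact_Times) auto
  have X_sub: "x \<in> \<Omega> - zero_coord" if xX: "x \<in> X" for x
  proof -
    obtain z t where x: "x = z + t *s 1" "z \<in> cball a e" "cmod t = r"
      using xX by (auto simp: X_def)
    have "dist a x \<le> norm (a - z) + norm (t *s (1 :: complex ^ 'n))"
      using norm_triangle_ineq4[of "a - z" "t *s 1"] by (simp add: x(1) dist_norm algebra_simps)
    also have "\<dots> \<le> s / 2 + s / 2"
      using x e rs by (intro add_mono) (auto simp: dist_norm norm_vector_smult)
    finally have "x \<in> \<Omega>"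
      using s by auto
    moreover have "x \<notin> zero_coord"
    proof
      assume "x \<in> zero_coord"
      then obtain i where "z $ i + t = 0"
        by (auto simp: zero_coord_def x(1))
      then have "cmod (z $ i) = r"
        using x(3) by (metis add_eq_0_iff norm_minus_cancel)
      then have "\<delta> \<le> \<bar>cmod (a $ i) - cmod (z $ i)\<bar>"
        using \<delta> by metis
      also have "\<dots> \<le> cmod ((a - z) $ i)"
        by (simp add: norm_triangle_ineq3)
      also have "\<dots> \<le> norm (a - z)"
        by (rule Finite_Cartesian_Product.norm_nth_le)
      also have "\<dots> \<le> e"
        using x(2) by (simp add: dist_norm)
      finally show False
        using e(2) by simp
    qed
    ultimately show ?thesis
      by blast
  qed
  obtain Q C where Q: "compact Q" "Q \<subseteq> \<Omega>" "C \<ge> 0"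
    "\<forall>z\<in>X. dominated (hol UNIV) Q C (\<lambda>f. T (\<lambda>w. f (z * w)))"
    using dominated_compact[OF X carried_bound_off_zero_coord[OF op T X_sub]] by blast
  \<comment> \<open>Restricted to polynomials, for which \<open>z \<mapsto> T(p(z\<cdot>))\<close>
    is known to be holomorphic on the whole disc and not merely near its boundary circle.\<close>
  have "dominated (Collect polynomial_fun) Q C (\<lambda>f. T (\<lambda>w. f (z * w)))" if z: "z \<in> ball a e" for z
    unfolding dominated_def
  proof (intro ballI allI impI)
    fix p B assume p: "p \<in> Collect polynomial_fun" and B: "0 \<le> (B :: real)" "\<forall>x\<in>Q. cmod (p x) \<le> B"
    have hp: "(\<lambda>z. T (\<lambda>w. p (z * w))) \<in> hol UNIV"
      using p by (intro polynomial_fun_hol polynomial_fun_dilate_functional[OF lin]) auto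
    show "cmod (T (\<lambda>w. p (z * w))) \<le> C * B"
    proof (rule cdiff_line_maximum_modulus[OF r0, of "\<lambda>z. T (\<lambda>w. p (z * w))" z 1])
      show "cdiff (\<lambda>z. T (\<lambda>w. p (z * w))) (z + t *s 1)" for t
        using hp by (rule hol_cdiff) simp
      fix t :: complex assume t: "cmod t = r"
      have "z + t *s 1 \<in> X"
        unfolding X_def using z t by (intro image_eqI[of _ _ "(z, t)"]) auto
      then show "cmod (T (\<lambda>w. p ((z + t *s 1) * w))) \<le> C * B"
        using p polynomial_fun_hol B by (intro dominatedD[OF Q(4)[rule_format]]) auto
    qed
  qed
  then show ?thesis
    using e(1) Q(1-3) by blast
qed

lemma carried_bound:
  assumes "open \<Omega>" "T \<in> carried_functionals \<Omega>" "compact X" "X \<subseteq> \<Omega>"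
  shows "\<exists>Q C. compact Q \<and> Q \<subseteq> \<Omega> \<and> C \<ge> 0 \<and>
    (\<forall>z\<in>X. dominated (Collect polynomial_fun) Q C (\<lambda>f. T (\<lambda>w. f (z * w))))"
  using assms by (intro dominated_compact carried_bound_local) auto

text \<open>The bound is obtained together with \<open>g\<close>, because at zero coordinates
  \<open>g\<close> is accessible only as the limit of the polynomials that define it. It later
  yields continuity of \<open>\<Phi>(T)\<close>.\<close>

lemma Phi_value_bound:
  fixes \<Omega> :: "(complex ^ 'n) set"
  assumes \<Omega>: "runge_domain \<Omega>" and T: "T \<in> carried_functionals \<Omega>" and f: "f \<in> hol \<Omega>"
  obtains g where "Phi_value \<Omega> T f g"
    "\<And>z Q C B. z \<in> \<Omega> \<Longrightarrow> compact Q \<Longrightarrow> Q \<subseteq> \<Omega> \<Longrightarrow> C \<ge> 0 \<Longrightarrow>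
       dominated (Collect polynomial_fun) Q C (\<lambda>f. T (\<lambda>w. f (z * w))) \<Longrightarrow>
       B \<ge> 0 \<Longrightarrow> (\<And>x. x \<in> Q \<Longrightarrow> cmod (f x) \<le> B) \<Longrightarrow> cmod (g z) \<le> C * B"
proof -
  note op = runge_domain_open[OF \<Omega>]
  have lin: "lin_functional UNIV T"
    using T hol_dual_lin by (auto simp: carried_functionals_def)
  obtain p where p: "\<And>k. polynomial_fun (p k)"
    "\<And>K. compact K \<Longrightarrow> K \<subseteq> \<Omega> \<Longrightarrow> uniform_limit K p f sequentially"
    using runge_domain_sequence[OF \<Omega> f] by blast
  define P where "P = (\<lambda>k z. T (\<lambda>w. p k (z * w)))"
  have dil: "(\<lambda>w. p k (z * w)) \<in> hol UNIV" for k z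
    using hol_UNIV_affine[OF polynomial_fun_hol[OF p(1)], of k 0 z] by simp
  have poly_diff: "polynomial_fun (\<lambda>z. p m z - p k z)" for m k
    using polynomial_fun_add[OF p(1)[of m] polynomial_fun_mult[OF polynomial_fun_const[of "-1"] p(1)[of k]]] by simp
  have "\<exists>g\<in>hol \<Omega>. \<forall>z\<in>\<Omega>. (\<lambda>k. P k z) \<longlonglongrightarrow> g z"
  proof (rule hol_locally_uniform_limit[OF op])
    show "cdiff (P k) z" for k z
      unfolding P_def
      using polynomial_fun_hol[OF polynomial_fun_dilate_functional[OF lin p(1)]] by (rule hol_cdiff) simp
    fix X assume X: "compact X" "X \<subseteq> \<Omega>"
    obtain Q C where Q: "compact Q" "Q \<subseteq> \<Omega>" "C \<ge> 0"
      "\<forall>z\<in>X. dominated (Collect polynomial_fun) Q C (\<lambda>f. T (\<lambda>w. f (z * w)))"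
      using carried_bound[OF op T X] by blast
    show "uniformly_Cauchy_on X P"
      unfolding P_def
      by (rule dominated_uniformly_Cauchy[where T = "\<lambda>z f. T (\<lambda>w. f (z * w))", OF Q(4)[rule_format] Q(3)])
         (use poly_diff lin_functional_diff[OF lin dil dil] p(2)[OF Q(1,2)] in auto)
  qed
  then obtain g where g: "g \<in> hol \<Omega>" "\<And>z. z \<in> \<Omega> \<Longrightarrow> (\<lambda>k. P k z) \<longlonglongrightarrow> g z"
    by blast
  have "Phi_value \<Omega> T f g"
    unfolding Phi_value_def
  proof (intro conjI ballI g(1))
    fix z assume z: "z \<in> \<Omega> - zero_coord"
    define S where "S = functional_at \<Omega> T z"
    define U where "U = inv_dilate z \<Omega>"
    have U: "open U" "U = {w. z * w \<in> \<Omega>}"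
      unfolding U_def using z op by (blast intro: open_inv_dilate, simp add: inv_dilate_eq)
    have S: "S \<in> hol_dual U" "\<And>f. f \<in> hol UNIV \<Longrightarrow> S (restr U f) = T f"
      using functional_at_extends(2)[OF \<Omega> T z] by (auto simp: extends_functional_def S_def U_def)
    obtain K C where K: "compact K" "K \<subseteq> U" "C \<ge> 0" "dominated (hol U) K C S"
      using hol_dual_dominated[OF S(1)] .
    have "compact ((\<lambda>w. z * w) ` K)" "(\<lambda>w. z * w) ` K \<subseteq> \<Omega>"
      using K U by (auto intro!: compact_continuous_image continuous_intros)
    then have "uniform_limit ((\<lambda>w. z * w) ` K) p f sequentially"
      by (rule p(2))
    then have ul: "uniform_limit K (\<lambda>k. restr U (\<lambda>w. p k (z * w))) (\<lambda>w. f (z * w)) sequentially"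
      using K(2) by (auto simp: uniform_limit_iff restr_def subset_iff elim!: eventually_mono)
    have "(\<lambda>k. S (restr U (\<lambda>w. p k (z * w)))) \<longlonglongrightarrow> S (\<lambda>w. f (z * w))"
    proof (rule dominated_tendsto[OF hol_dual_lin[OF S(1)] K(4,3) _ _ ul])
      show "restr U (\<lambda>w. p k (z * w)) \<in> hol U" for k
        using restr_hol[OF dil U(1)] by simp
      show "(\<lambda>w. f (z * w)) \<in> hol U"
        unfolding U_def using z f by (intro hol_dilate) auto
    qed
    \<comment> \<open>\<open>S\<close> agrees with \<open>T\<close> on entire functions, so
      continuity of \<open>S\<close> identifies the limit of \<open>P k z\<close> with the
      prescribed value.\<close>
    then have "(\<lambda>k. P k z) \<longlonglongrightarrow> S (\<lambda>w. f (z * w))"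
      using S(2)[OF dil] by (simp add: P_def)
    then show "g z = functional_at \<Omega> T z (\<lambda>w. f (z * w))"
      using g(2) z LIMSEQ_unique unfolding S_def by blast
  qed
  moreover have "cmod (g z) \<le> C * B"
    if "z \<in> \<Omega>" "compact Q" "Q \<subseteq> \<Omega>" "C \<ge> 0"
      "dominated (Collect polynomial_fun) Q C (\<lambda>f. T (\<lambda>w. f (z * w)))" "B \<ge> 0"
      "\<And>x. x \<in> Q \<Longrightarrow> cmod (f x) \<le> B" for z Q C B
    using dominated_limit_bound[OF that(5,4) _ p(2)[OF that(2,3)] g(2)[OF that(1), unfolded P_def] that(6,7)]
      p(1) by simp
  ultimately show ?thesis
    by (rule that)
qed

lemma Phi_value_unique:
  assumes "open \<Omega>" "Phi_value \<Omega> T f g" "Phi_value \<Omega> T f h"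
  shows "g = h"
  using assms by (intro hol_eqI_off_zero_coord[OF assms(1)]) (auto simp: Phi_value_def)

lemma Phi_eqI:
  assumes "open \<Omega>" "f \<in> hol \<Omega>" "Phi_value \<Omega> T f g"
  shows "Phi \<Omega> T f = g"
  unfolding Phi_def using assms Phi_value_unique[OF assms(1)] by (auto intro!: the_equality)

lemma Phi_value_Phi:
  assumes "runge_domain \<Omega>" "T \<in> carried_functionals \<Omega>" "f \<in> hol \<Omega>"
  shows "Phi_value \<Omega> T f (Phi \<Omega> T f)"
  by (rule Phi_value_bound[OF assms]) (use Phi_eqI[OF runge_domain_open[OF assms(1)] assms(3)] in auto)

text \<open>A bound on polynomials passes to \<open>hol \<Omega>\<close> along the approximating
  sequence, with unchanged \<open>Q\<close> and \<open>C\<close>.\<close>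

lemma Phi_bound:
  assumes "runge_domain \<Omega>" "T \<in> carried_functionals \<Omega>" "compact X" "X \<subseteq> \<Omega>"
  shows "\<exists>Q C. compact Q \<and> Q \<subseteq> \<Omega> \<and> C \<ge> 0 \<and> (\<forall>z\<in>X. dominated (hol \<Omega>) Q C (\<lambda>f. Phi \<Omega> T f z))"
proof -
  note op = runge_domain_open[OF assms(1)]
  obtain Q C where Q: "compact Q" "Q \<subseteq> \<Omega>" "C \<ge> 0"
    "\<forall>z\<in>X. dominated (Collect polynomial_fun) Q C (\<lambda>f. T (\<lambda>w. f (z * w)))"
    using carried_bound[OF op assms(2-4)] by blast
  have "cmod (Phi \<Omega> T f z) \<le> C * B"
    if z: "z \<in> X" and f: "f \<in> hol \<Omega>" and B: "B \<ge> 0" "\<forall>x\<in>Q. cmod (f x) \<le> B" for z f B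
  proof (rule Phi_value_bound[OF assms(1,2) f])
    fix g
    assume g: "Phi_value \<Omega> T f g"
      "\<And>z Q C B. z \<in> \<Omega> \<Longrightarrow> compact Q \<Longrightarrow> Q \<subseteq> \<Omega> \<Longrightarrow> C \<ge> 0 \<Longrightarrow>
       dominated (Collect polynomial_fun) Q C (\<lambda>f. T (\<lambda>w. f (z * w))) \<Longrightarrow>
       B \<ge> 0 \<Longrightarrow> (\<And>x. x \<in> Q \<Longrightarrow> cmod (f x) \<le> B) \<Longrightarrow> cmod (g z) \<le> C * B"
    have "cmod (g z) \<le> C * B"
      using z assms(4) B by (intro g(2)[OF _ Q(1-3) Q(4)[rule_format]]) auto
    then show ?thesis
      using Phi_eqI[OF op f g(1)] by simp
  qed
  then have "\<forall>z\<in>X. dominated (hol \<Omega>) Q C (\<lambda>f. Phi \<Omega> T f z)"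
    unfolding dominated_def by blast
  then show ?thesis
    using Q by blast
qed

section \<open>Multipliers as dominated operators\<close>

lemma lin_functional_eval:
  assumes "lin_on fscale fscale (hol \<Omega>) M"
  shows "lin_functional \<Omega> (\<lambda>f. M f z)"
  using assms by (simp add: lin_on_def fscale_def)

text \<open>The functions of modulus below 1 on \<open>X\<close> form an open set; its preimage
  contains all functions small on some compact set, which then serves every \<open>z\<close> in
  \<open>X\<close>.\<close>

lemma operator_dominated:
  fixes \<Omega> :: "(complex ^ 'n) set"
  assumes M: "lin_on fscale fscale (hol \<Omega>) M" "continuous_map (hol_top \<Omega>) (hol_top \<Omega>) M"
    and X: "compact X" "X \<subseteq> \<Omega>"
  shows "\<exists>Q C. compact Q \<and> Q \<subseteq> \<Omega> \<and> C \<ge> 0 \<and> (\<forall>z\<in>X. dominated (hol \<Omega>) Q C (\<lambda>f. M f z))"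
proof -
  define V where "V = {h \<in> hol \<Omega>. \<forall>z\<in>X. cmod (h z) < 1}"
  have "hol_open \<Omega> V"
    unfolding hol_open_def
  proof (intro conjI ballI)
    show "V \<subseteq> hol \<Omega>"
      by (auto simp: V_def)
    fix f assume f: "f \<in> V"
    \<comment> \<open>The maximum over the compact \<open>X\<close> is attained and so stays below 1
      by a margin; an empty \<open>X\<close> has no maximum and is split off.\<close>
    have "\<exists>e>0. \<forall>z\<in>X. cmod (f z) + e \<le> 1"
    proof (cases "X = {}")
      case False
      have "continuous_on X (\<lambda>z. cmod (f z))"
        using f X(2) hol_continuous_on continuous_on_subset by (fastforce simp: V_def intro: continuous_on_norm)
      then obtain y where y: "y \<in> X" "\<forall>z\<in>X. cmod (f z) \<le> cmod (f y)"
        using continuous_attains_sup[OF X(1) False] by blast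
      then show ?thesis
        using f by (intro exI[of _ "1 - cmod (f y)"]) (auto simp: V_def)
    qed (auto intro: exI[of _ 1])
    then obtain e where e: "e > 0" "\<And>z. z \<in> X \<Longrightarrow> cmod (f z) + e \<le> 1"
      by blast
    have "g \<in> V" if g: "g \<in> hol \<Omega>" "\<forall>z\<in>X. dist (g z) (f z) < e" for g
    proof -
      have "cmod (g z) < 1" if "z \<in> X" for z
        using g(2)[rule_format, OF that] e(2)[OF that] norm_triangle_sub[of "g z" "f z"]
        by (simp add: dist_norm)
      then show ?thesis
        using g(1) by (simp add: V_def)
    qed
    then show "\<exists>K e. compact K \<and> K \<subseteq> \<Omega> \<and> e > 0 \<and> {g \<in> hol \<Omega>. \<forall>z\<in>K. dist (g z) (f z) < e} \<subseteq> V"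
      using X e(1) by blast
  qed
  then have "openin (hol_top \<Omega>) {f \<in> topspace (hol_top \<Omega>). M f \<in> V}"
    by (intro openin_continuous_map_preimage[OF M(2)]) (simp add: openin_hol_top)
  then have op: "hol_open \<Omega> {f \<in> hol \<Omega>. M f \<in> V}"
    by (simp add: openin_hol_top topspace_hol_top)
  have M0: "M 0 = 0"
    using lin_functional_zero[OF lin_functional_eval[OF M(1)]] by (simp add: fun_eq_iff)
  have zero: "0 \<in> {f \<in> hol \<Omega>. M f \<in> V}"
    using hol_zero[of \<Omega>] by (simp add: M0 V_def)
  have "\<exists>K e. compact K \<and> K \<subseteq> \<Omega> \<and> e > 0 \<and>
      {g \<in> hol \<Omega>. \<forall>z\<in>K. dist (g z) ((0 :: complex ^ 'n \<Rightarrow> complex) z) < e} \<subseteq> {f \<in> hol \<Omega>. M f \<in> V}"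
    using op[unfolded hol_open_def, THEN conjunct2] zero by (rule bspec)
  then obtain K e where K: "compact K" "K \<subseteq> \<Omega>" "e > 0"
      "{g \<in> hol \<Omega>. \<forall>z\<in>K. dist (g z) ((0 :: complex ^ 'n \<Rightarrow> complex) z) < e} \<subseteq> {f \<in> hol \<Omega>. M f \<in> V}"
    by (elim exE conjE)
  have "dominated (hol \<Omega>) K (2 / e) (\<lambda>f. M f z)" if z: "z \<in> X" for z
  proof (rule dominatedI_unit[OF lin_functional_eval[OF M(1)] K(3)])
    fix g assume "g \<in> hol \<Omega>" "\<forall>z\<in>K. cmod (g z) < e"
    then have "g \<in> {g \<in> hol \<Omega>. \<forall>z\<in>K. dist (g z) ((0 :: complex ^ 'n \<Rightarrow> complex) z) < e}"
      by simp
    then have "M g \<in> V"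
      using K(4) by blast
    then show "cmod (M g z) < 1"
      using z by (simp add: V_def)
  qed
  then show ?thesis
    using K by (intro exI[of _ K] exI[of _ "2 / e"]) auto
qed

text \<open>By linearity, \<open>M g - M f\<close> on \<open>X\<close> is controlled by
  \<open>g - f\<close> on \<open>Q\<close>.\<close>

lemma operator_continuous:
  fixes \<Omega> :: "(complex ^ 'n) set"
  assumes M: "M ` hol \<Omega> \<subseteq> hol \<Omega>" "lin_on fscale fscale (hol \<Omega>) M"
    and dom: "\<And>X. compact X \<Longrightarrow> X \<subseteq> \<Omega> \<Longrightarrow>
      \<exists>Q C. compact Q \<and> Q \<subseteq> \<Omega> \<and> C \<ge> 0 \<and> (\<forall>z\<in>X. dominated (hol \<Omega>) Q C (\<lambda>f. M f z))"
  shows "continuous_map (hol_top \<Omega>) (hol_top \<Omega>) M"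
  unfolding continuous_map_def
proof (intro conjI allI impI)
  show "M \<in> topspace (hol_top \<Omega>) \<rightarrow> topspace (hol_top \<Omega>)"
    using M(1) by (auto simp: topspace_hol_top)
  fix U assume "openin (hol_top \<Omega>) U"
  then have U: "hol_open \<Omega> U"
    by (simp add: openin_hol_top)
  have "hol_open \<Omega> {f \<in> hol \<Omega>. M f \<in> U}"
    unfolding hol_open_def
  proof (intro conjI ballI)
    fix f assume f: "f \<in> {f \<in> hol \<Omega>. M f \<in> U}"
    then have "\<exists>X e. compact X \<and> X \<subseteq> \<Omega> \<and> e > 0 \<and> {g \<in> hol \<Omega>. \<forall>z\<in>X. dist (g z) (M f z) < e} \<subseteq> U"
      using U unfolding hol_open_def by simp
    then obtain X e where X: "compact X" "X \<subseteq> \<Omega>" "e > 0"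
      "{g \<in> hol \<Omega>. \<forall>z\<in>X. dist (g z) (M f z) < e} \<subseteq> U"
      by (elim exE conjE)
    obtain Q C where Q: "compact Q" "Q \<subseteq> \<Omega>" "C \<ge> 0" "\<forall>z\<in>X. dominated (hol \<Omega>) Q C (\<lambda>f. M f z)"
      using dom[OF X(1,2)] by blast
    define d where "d = e / (C + 1)"
    have d: "d > 0" "C * d < e"
      using X(3) Q(3) by (auto simp: d_def field_simps)
    have "M g \<in> U" if g: "g \<in> hol \<Omega>" "\<forall>z\<in>Q. dist (g z) (f z) < d" for g
    proof -
      have "dist (M g z) (M f z) < e" if z: "z \<in> X" for z
      proof -
        have "cmod (M (\<lambda>z. g z - f z) z) \<le> C * d"
        proof (rule dominatedD[OF Q(4)[rule_format, OF z]])
          show "(\<lambda>z. g z - f z) \<in> hol \<Omega>"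
            using f g by (intro hol_diff) auto
          show "cmod (g w - f w) \<le> d" if "w \<in> Q" for w
            using g(2)[rule_format, OF that] by (simp add: dist_norm)
        qed (use d in auto)
        then show ?thesis
          using lin_functional_diff[OF lin_functional_eval[OF M(2)] g(1), of f z] f d(2)
          by (simp add: dist_norm)
      qed
      moreover have "M g \<in> hol \<Omega>"
        using M(1) g(1) by blast
      ultimately show ?thesis
        using X(4) by blast
    qed
    then show "\<exists>K e. compact K \<and> K \<subseteq> \<Omega> \<and> e > 0 \<and>
        {g \<in> hol \<Omega>. \<forall>z\<in>K. dist (g z) (f z) < e} \<subseteq> {f \<in> hol \<Omega>. M f \<in> U}"
      using Q(1,2) d(1) by blast
  qed auto
  then show "openin (hol_top \<Omega>) {f \<in> topspace (hol_top \<Omega>). M f \<in> U}"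
    by (simp add: openin_hol_top topspace_hol_top)
qed

lemma multipliers_dominated:
  assumes "M \<in> multipliers \<Omega>" "compact X" "X \<subseteq> \<Omega>"
  shows "\<exists>Q C. compact Q \<and> Q \<subseteq> \<Omega> \<and> C \<ge> 0 \<and> (\<forall>z\<in>X. dominated (hol \<Omega>) Q C (\<lambda>f. M f z))"
  using assms by (intro operator_dominated) (auto simp: multipliers_def)

lemma multipliersI:
  assumes "M ` hol \<Omega> \<subseteq> hol \<Omega>" "lin_on fscale fscale (hol \<Omega>) M" "multiplier_seq \<Omega> M m"
    "\<And>f. f \<notin> hol \<Omega> \<Longrightarrow> M f = 0"
    "\<And>X. compact X \<Longrightarrow> X \<subseteq> \<Omega> \<Longrightarrow>
      \<exists>Q C. compact Q \<and> Q \<subseteq> \<Omega> \<and> C \<ge> 0 \<and> (\<forall>z\<in>X. dominated (hol \<Omega>) Q C (\<lambda>f. M f z))"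
  shows "M \<in> multipliers \<Omega>"
proof -
  have "continuous_map (hol_top \<Omega>) (hol_top \<Omega>) M"
    using assms(1,2,5) by (rule operator_continuous)
  then show ?thesis
    using assms(1-4) by (auto simp: multipliers_def)
qed

section \<open>The vector spaces of multipliers and of carried functionals\<close>

lemma subspace_multipliers:
  fixes \<Omega> :: "(complex ^ 'n) set"
  shows "module.subspace opscale (multipliers \<Omega>)"
proof -
  interpret module "opscale :: complex \<Rightarrow> ((complex ^ 'n \<Rightarrow> complex) \<Rightarrow> (complex ^ 'n \<Rightarrow> complex)) \<Rightarrow> _"
    using vector_space_opscale by (simp add: module_iff_vector_space)
  show ?thesis
  proof (rule subspaceI)
    show "0 \<in> multipliers \<Omega>"
    proof (rule multipliersI[where m = "\<lambda>_. 0"])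
      show "\<exists>Q C. compact Q \<and> Q \<subseteq> \<Omega> \<and> C \<ge> 0 \<and>
          (\<forall>z\<in>X. dominated (hol \<Omega>) Q C (\<lambda>f. (0 :: (complex ^ 'n \<Rightarrow> complex) \<Rightarrow> complex ^ 'n \<Rightarrow> complex) f z))" for X
        by (rule exI[of _ "{}"], rule exI[of _ 0]) (simp add: dominated_zero)
    qed (use hol_zero[of \<Omega>] in
        \<open>auto simp: multiplier_seq_def lin_on_def fscale_def zero_fun_def plus_fun_def\<close>)
  next
    fix M N assume M: "M \<in> multipliers \<Omega>" and N: "N \<in> multipliers \<Omega>"
    obtain m where m: "multiplier_seq \<Omega> M m"
      using M by (auto simp: multipliers_def)
    obtain n where n: "multiplier_seq \<Omega> N n"
      using N by (auto simp: multipliers_def)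
    show "M + N \<in> multipliers \<Omega>"
    proof (rule multipliersI)
      show "multiplier_seq \<Omega> (M + N) (\<lambda>\<alpha>. m \<alpha> + n \<alpha>)"
        using m n by (simp add: multiplier_seq_def fscale_def plus_fun_def distrib_right)
      show "lin_on fscale fscale (hol \<Omega>) (M + N)"
        using M N by (simp add: multipliers_def lin_on_def fscale_def fun_eq_iff algebra_simps)
      show "(M + N) ` hol \<Omega> \<subseteq> hol \<Omega>"
        using M N by (auto simp: multipliers_def image_subset_iff intro!: hol_add)
      show "(M + N) f = 0" if "f \<notin> hol \<Omega>" for f
        using M N that by (simp add: multipliers_def)
      fix X assume X: "compact X" "X \<subseteq> \<Omega>"
      obtain Q C where Q: "compact Q" "Q \<subseteq> \<Omega>" "C \<ge> 0" "\<forall>z\<in>X. dominated (hol \<Omega>) Q C (\<lambda>f. M f z)"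
        using multipliers_dominated[OF M X] by (elim exE conjE)
      obtain R D where R: "compact R" "R \<subseteq> \<Omega>" "D \<ge> 0" "\<forall>z\<in>X. dominated (hol \<Omega>) R D (\<lambda>f. N f z)"
        using multipliers_dominated[OF N X] by (elim exE conjE)
      have "\<forall>z\<in>X. dominated (hol \<Omega>) (Q \<union> R) (C + D) (\<lambda>f. (M + N) f z)"
        using dominated_add[OF Q(4)[rule_format] R(4)[rule_format]] by simp
      then show "\<exists>Q C. compact Q \<and> Q \<subseteq> \<Omega> \<and> C \<ge> 0 \<and> (\<forall>z\<in>X. dominated (hol \<Omega>) Q C (\<lambda>f. (M + N) f z))"
        using Q R by (intro exI[of _ "Q \<union> R"] exI[of _ "C + D"]) (simp add: compact_Un)
    qed
  next
    fix c M assume M: "M \<in> multipliers \<Omega>"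
    obtain m where m: "multiplier_seq \<Omega> M m"
      using M by (auto simp: multipliers_def)
    show "opscale c M \<in> multipliers \<Omega>"
    proof (rule multipliersI)
      show "multiplier_seq \<Omega> (opscale c M) (\<lambda>\<alpha>. c * m \<alpha>)"
        using m by (simp add: multiplier_seq_def fscale_def opscale_def mult.assoc)
      show "lin_on fscale fscale (hol \<Omega>) (opscale c M)"
        using M by (simp add: multipliers_def lin_on_def fscale_def opscale_def fun_eq_iff algebra_simps)
      show "opscale c M ` hol \<Omega> \<subseteq> hol \<Omega>"
        using M by (auto simp: multipliers_def image_subset_iff opscale_def intro!: hol_fscale)
      show "opscale c M f = 0" if "f \<notin> hol \<Omega>" for f
        using M that by (simp add: multipliers_def opscale_def fscale_def fun_eq_iff)
      fix X assume X: "compact X" "X \<subseteq> \<Omega>"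
      obtain Q C where Q: "compact Q" "Q \<subseteq> \<Omega>" "C \<ge> 0" "\<forall>z\<in>X. dominated (hol \<Omega>) Q C (\<lambda>f. M f z)"
        using multipliers_dominated[OF M X] by (elim exE conjE)
      have "\<forall>z\<in>X. dominated (hol \<Omega>) Q (cmod c * C) (\<lambda>f. opscale c M f z)"
        using dominated_scale[OF Q(4)[rule_format], of _ c] by (simp add: opscale_def fscale_def)
      then show "\<exists>Q C. compact Q \<and> Q \<subseteq> \<Omega> \<and> C \<ge> 0 \<and> (\<forall>z\<in>X. dominated (hol \<Omega>) Q C (\<lambda>f. opscale c M f z))"
        using Q by (intro exI[of _ Q] exI[of _ "cmod c * C"]) simp
    qed
  qed
qed

lemma subspace_carried_functionals:
  fixes \<Omega> :: "(complex ^ 'n) set"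
  assumes "open \<Omega>"
  shows "module.subspace fscale (carried_functionals \<Omega>)"
proof -
  interpret module "fscale :: complex \<Rightarrow> ((complex ^ 'n \<Rightarrow> complex) \<Rightarrow> complex) \<Rightarrow> _"
    using vector_space_fscale by (simp add: module_iff_vector_space)
  note iff = carried_functionals_iff[OF assms]
  show ?thesis
  proof (rule subspaceI)
    \<comment> \<open>The empty set lies in every dilate and supports the bound for the zero
      functional.\<close>
    have "dominated (hol UNIV) {} 0 (0 :: (complex ^ 'n \<Rightarrow> complex) \<Rightarrow> complex)"
      using dominated_zero by (simp add: zero_fun_def)
    moreover from this have "0 \<in> hol_dual (UNIV :: (complex ^ 'n) set)"
      by (intro hol_dualI[of _ _ "{}" 0]) (auto simp: lin_on_def)
    ultimately show "0 \<in> carried_functionals \<Omega>"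
      unfolding iff by (meson compact_empty empty_subsetI order_refl)
  next
    fix S T assume S: "S \<in> carried_functionals \<Omega>" and T: "T \<in> carried_functionals \<Omega>"
    have SD: "S \<in> hol_dual UNIV" and TD: "T \<in> hol_dual UNIV"
      using S T by (auto simp: iff)
    have add: "dominated (hol UNIV) (K \<union> L) (C + D) (S + T)"
      if "dominated (hol UNIV) K C S" "dominated (hol UNIV) L D T" for K L C D
      using dominated_add[OF that] by (simp add: plus_fun_def)
    have "S + T \<in> hol_dual UNIV"
    proof -
      obtain K C where K: "compact K" "K \<subseteq> UNIV" "C \<ge> 0" "dominated (hol UNIV) K C S"
        using hol_dual_dominated[OF SD] .
      obtain L D where L: "compact L" "L \<subseteq> UNIV" "D \<ge> 0" "dominated (hol UNIV) L D T"
        using hol_dual_dominated[OF TD] .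
      show ?thesis
      proof (rule hol_dualI[OF _ add[OF K(4) L(4)]])
        show "lin_functional UNIV (S + T)"
          using hol_dual_lin[OF SD] hol_dual_lin[OF TD] by (simp add: lin_on_def algebra_simps)
      qed (use K L SD TD in \<open>auto simp: hol_dual_outside\<close>)
    qed
    moreover have "\<exists>K C. compact K \<and> K \<subseteq> inv_dilate z \<Omega> \<and> C \<ge> 0 \<and> dominated (hol UNIV) K C (S + T)"
      if z: "z \<in> \<Omega> - zero_coord" for z
    proof -
      obtain K C where K: "compact K" "K \<subseteq> inv_dilate z \<Omega>" "C \<ge> 0" "dominated (hol UNIV) K C S"
        using S z unfolding iff by blast
      obtain L D where L: "compact L" "L \<subseteq> inv_dilate z \<Omega>" "D \<ge> 0" "dominated (hol UNIV) L D T"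
        using T z unfolding iff by blast
      show ?thesis
        using add[OF K(4) L(4)] K L by (intro exI[of _ "K \<union> L"] exI[of _ "C + D"]) (simp add: compact_Un)
    qed
    ultimately show "S + T \<in> carried_functionals \<Omega>"
      unfolding iff by blast
  next
    fix c T assume T: "T \<in> carried_functionals \<Omega>"
    have TD: "T \<in> hol_dual UNIV"
      using T by (auto simp: iff)
    have scale: "dominated (hol UNIV) K (cmod c * C) (fscale c T)"
      if "dominated (hol UNIV) K C T" for K C
      using dominated_scale[OF that] by (simp add: fscale_def)
    have "fscale c T \<in> hol_dual UNIV"
    proof -
      obtain K C where K: "compact K" "K \<subseteq> UNIV" "C \<ge> 0" "dominated (hol UNIV) K C T"
        using hol_dual_dominated[OF TD] .
      show ?thesis
      proof (rule hol_dualI[OF _ scale[OF K(4)]])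
        show "lin_functional UNIV (fscale c T)"
          using hol_dual_lin[OF TD] by (simp add: lin_on_def fscale_def[of c T] algebra_simps)
      qed (use K TD in \<open>auto simp: hol_dual_outside fscale_def\<close>)
    qed
    moreover have "\<exists>K C. compact K \<and> K \<subseteq> inv_dilate z \<Omega> \<and> C \<ge> 0 \<and> dominated (hol UNIV) K C (fscale c T)"
      if z: "z \<in> \<Omega> - zero_coord" for z
    proof -
      obtain K C where K: "compact K" "K \<subseteq> inv_dilate z \<Omega>" "C \<ge> 0" "dominated (hol UNIV) K C T"
        using T z unfolding iff by blast
      show ?thesis
        using scale[OF K(4)] K by (intro exI[of _ K] exI[of _ "cmod c * C"]) simp
    qed
    ultimately show "fscale c T \<in> carried_functionals \<Omega>"
      unfolding iff by blast
  qed
qed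

section \<open>The map \<open>\<Phi>\<close>\<close>

lemma Phi_hol:
  assumes "runge_domain \<Omega>" "T \<in> carried_functionals \<Omega>" "f \<in> hol \<Omega>"
  shows "Phi \<Omega> T f \<in> hol \<Omega>"
  using Phi_value_Phi[OF assms] by (simp add: Phi_value_def)

lemma Phi_apply:
  assumes "runge_domain \<Omega>" "T \<in> carried_functionals \<Omega>" "f \<in> hol \<Omega>" "z \<in> \<Omega> - zero_coord"
  shows "Phi \<Omega> T f z = functional_at \<Omega> T z (\<lambda>w. f (z * w))"
  using Phi_value_Phi[OF assms(1-3)] assms(4) by (simp add: Phi_value_def)

lemma functional_at_lin:
  assumes "runge_domain \<Omega>" "T \<in> carried_functionals \<Omega>" "z \<in> \<Omega> - zero_coord"
  shows "lin_functional (inv_dilate z \<Omega>) (functional_at \<Omega> T z)"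
  using functional_at_extends(2)[OF assms] by (auto simp: extends_functional_def intro: hol_dual_lin)

text \<open>Linearity is inherited from \<open>T\<^sub>z\<close> at points without zero coordinates,
  where the formula holds, and extends by density.\<close>

lemma Phi_lin:
  assumes "runge_domain \<Omega>" "T \<in> carried_functionals \<Omega>"
  shows "lin_on fscale fscale (hol \<Omega>) (Phi \<Omega> T)"
  unfolding lin_on_def
proof (intro conjI ballI allI)
  note op = runge_domain_open[OF assms(1)]
  fix f g assume f: "f \<in> hol \<Omega>" and g: "g \<in> hol \<Omega>"
  show "Phi \<Omega> T (f + g) = Phi \<Omega> T f + Phi \<Omega> T g"
  proof (rule hol_eqI_off_zero_coord[OF op])
    fix z assume z: "z \<in> \<Omega> - zero_coord"
    have "functional_at \<Omega> T z ((\<lambda>w. f (z * w)) + (\<lambda>w. g (z * w))) =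
        functional_at \<Omega> T z (\<lambda>w. f (z * w)) + functional_at \<Omega> T z (\<lambda>w. g (z * w))"
      using functional_at_lin[OF assms z] hol_dilate[OF f] hol_dilate[OF g] z by (simp add: lin_on_def)
    then show "Phi \<Omega> T (f + g) z = (Phi \<Omega> T f + Phi \<Omega> T g) z"
      unfolding plus_fun_apply Phi_apply[OF assms hol_add[OF f g] z] Phi_apply[OF assms f z] Phi_apply[OF assms g z]
      by (simp add: plus_fun_def)
  qed (intro hol_add Phi_hol assms f g)+
next
  note op = runge_domain_open[OF assms(1)]
  fix c f assume f: "f \<in> hol \<Omega>"
  show "Phi \<Omega> T (fscale c f) = fscale c (Phi \<Omega> T f)"
  proof (rule hol_eqI_off_zero_coord[OF op])
    fix z assume z: "z \<in> \<Omega> - zero_coord"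
    have "functional_at \<Omega> T z (fscale c (\<lambda>w. f (z * w))) = c * functional_at \<Omega> T z (\<lambda>w. f (z * w))"
      using functional_at_lin[OF assms z] hol_dilate[OF f] z by (simp add: lin_on_def)
    then show "Phi \<Omega> T (fscale c f) z = fscale c (Phi \<Omega> T f) z"
      using Phi_apply[OF assms hol_fscale[OF f, of c] z] Phi_apply[OF assms f z] by (simp add: fscale_def)
  qed (intro hol_fscale Phi_hol assms f)+
qed

text \<open>For a monomial \<open>f\<close> the function \<open>f\<^sub>z\<close> is
  \<open>monomial \<alpha> z\<close> times the same monomial, and \<open>T\<^sub>z\<close> agrees
  with \<open>T\<close> on it.\<close>

lemma Phi_multiplier_seq:
  assumes "runge_domain \<Omega>" "T \<in> carried_functionals \<Omega>"
  shows "multiplier_seq \<Omega> (Phi \<Omega> T) (\<lambda>\<alpha>. T (monomial \<alpha>))"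
  unfolding multiplier_seq_def
proof
  fix \<alpha>
  note op = runge_domain_open[OF assms(1)]
  have mon: "restr \<Omega> (monomial \<alpha>) \<in> hol \<Omega>"
    using restr_hol[OF monomial_hol op] by simp
  show "Phi \<Omega> T (restr \<Omega> (monomial \<alpha>)) = fscale (T (monomial \<alpha>)) (restr \<Omega> (monomial \<alpha>))"
  proof (rule hol_eqI_off_zero_coord[OF op])
    fix z assume z: "z \<in> \<Omega> - zero_coord"
    then have mz: "restr \<Omega> (monomial \<alpha>) z = monomial \<alpha> z"
      by (simp add: restr_def)
    define U where "U = inv_dilate z \<Omega>"
    have "open U"
      unfolding U_def using z op by (intro open_inv_dilate) auto
    then have "restr U (monomial \<alpha>) \<in> hol U"
      using restr_hol[OF monomial_hol] by simp
    moreover have "(\<lambda>w. restr \<Omega> (monomial \<alpha>) (z * w)) = fscale (monomial \<alpha> z) (restr U (monomial \<alpha>))"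
      using z by (auto simp: restr_def fscale_def monomial_dilate U_def inv_dilate_eq fun_eq_iff)
    moreover have "functional_at \<Omega> T z (restr U (monomial \<alpha>)) = T (monomial \<alpha>)"
      using functional_at_extends(2)[OF assms z] monomial_hol by (auto simp: extends_functional_def U_def)
    ultimately have "functional_at \<Omega> T z (\<lambda>w. restr \<Omega> (monomial \<alpha>) (z * w)) = monomial \<alpha> z * T (monomial \<alpha>)"
      using functional_at_lin[OF assms z] by (simp add: lin_on_def U_def)
    then show "Phi \<Omega> T (restr \<Omega> (monomial \<alpha>)) z = fscale (T (monomial \<alpha>)) (restr \<Omega> (monomial \<alpha>)) z"
      unfolding Phi_apply[OF assms mon z] using mz by (simp add: fscale_def mult.commute)
  qed (intro hol_fscale Phi_hol assms mon)+
qed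

lemma Phi_multipliers:
  assumes "runge_domain \<Omega>" "T \<in> carried_functionals \<Omega>"
  shows "Phi \<Omega> T \<in> multipliers \<Omega>"
proof (rule multipliersI)
  show "Phi \<Omega> T ` hol \<Omega> \<subseteq> hol \<Omega>"
    using Phi_hol[OF assms] by blast
  show "multiplier_seq \<Omega> (Phi \<Omega> T) (\<lambda>\<alpha>. T (monomial \<alpha>))"
    by (rule Phi_multiplier_seq[OF assms])
  show "lin_on fscale fscale (hol \<Omega>) (Phi \<Omega> T)"
    by (rule Phi_lin[OF assms])
  show "Phi \<Omega> T f = 0" if "f \<notin> hol \<Omega>" for f
    using that by (simp add: Phi_def)
qed (rule Phi_bound[OF assms])

text \<open>Evaluation at \<open>z\<close> after a multiplier is a continuous functional with
  moments \<open>m \<alpha> * monomial \<alpha> z\<close>, hence determined by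
  \<open>m\<close>.\<close>

lemma multipliers_eqI:
  assumes \<Omega>: "runge_domain \<Omega>" and M: "M \<in> multipliers \<Omega>" "multiplier_seq \<Omega> M m"
    and N: "N \<in> multipliers \<Omega>" "multiplier_seq \<Omega> N m"
  shows "M = N"
proof (intro ext)
  fix f z
  have eval: "(\<lambda>f. L f z) \<in> hol_dual \<Omega>" if L: "L \<in> multipliers \<Omega>" and z: "z \<in> \<Omega>" for L
  proof -
    obtain Q C where Q: "compact Q" "Q \<subseteq> \<Omega>" "C \<ge> 0" "\<forall>w\<in>{z}. dominated (hol \<Omega>) Q C (\<lambda>f. L f w)"
      using multipliers_dominated[OF L, of "{z}"] z by auto
    have lin: "lin_functional \<Omega> (\<lambda>f. L f z)"
      using L by (intro lin_functional_eval) (simp add: multipliers_def)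
    show ?thesis
      using L Q(4) by (intro hol_dualI[OF lin _ Q(3,1,2)]) (auto simp: multipliers_def)
  qed
  show "M f z = N f z"
  proof (cases "z \<in> \<Omega>")
    case True
    have "(\<lambda>f. M f z) = (\<lambda>f. N f z)"
      using M(2) N(2)
      by (intro hol_dual_eqI_moments[OF \<Omega> eval[OF M(1) True] eval[OF N(1) True]])
         (simp add: multiplier_seq_def)
    then show ?thesis
      by metis
  next
    case False
    have zero: "L f z = 0" if "L \<in> multipliers \<Omega>" for L
      using that False by (cases "f \<in> hol \<Omega>") (auto simp: multipliers_def intro: hol_outside)
    show ?thesis
      using zero[OF M(1)] zero[OF N(1)] by simp
  qed
qed

text \<open>The moments of \<open>T\<close> are linear in \<open>T\<close>, and multipliers with
  equal sequences coincide; this bypasses any comparison of the functionals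
  \<open>T\<^sub>z\<close>.\<close>

lemma Phi_linear:
  fixes \<Omega> :: "(complex ^ 'n) set"
  assumes \<Omega>: "runge_domain \<Omega>"
  shows "lin_on fscale opscale (carried_functionals \<Omega>) (Phi \<Omega>)"
proof -
  interpret F: module "fscale :: complex \<Rightarrow> ((complex ^ 'n \<Rightarrow> complex) \<Rightarrow> complex) \<Rightarrow> _"
    using vector_space_fscale by (simp add: module_iff_vector_space)
  interpret O: module "opscale :: complex \<Rightarrow> ((complex ^ 'n \<Rightarrow> complex) \<Rightarrow> (complex ^ 'n \<Rightarrow> complex)) \<Rightarrow> _"
    using vector_space_opscale by (simp add: module_iff_vector_space)
  note sub = subspace_carried_functionals[OF runge_domain_open[OF \<Omega>]] subspace_multipliers[of \<Omega>]
  note Phi = Phi_multipliers[OF \<Omega>] Phi_multiplier_seq[OF \<Omega>]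
  show ?thesis
    unfolding lin_on_def
  proof (intro conjI ballI allI)
    fix S T assume S: "S \<in> carried_functionals \<Omega>" and T: "T \<in> carried_functionals \<Omega>"
    have ST: "S + T \<in> carried_functionals \<Omega>"
      using F.subspace_add[OF sub(1) S T] .
    show "Phi \<Omega> (S + T) = Phi \<Omega> S + Phi \<Omega> T"
    proof (rule multipliers_eqI[OF \<Omega> Phi[OF ST]])
      show "Phi \<Omega> S + Phi \<Omega> T \<in> multipliers \<Omega>"
        using O.subspace_add[OF sub(2) Phi(1)[OF S] Phi(1)[OF T]] .
      show "multiplier_seq \<Omega> (Phi \<Omega> S + Phi \<Omega> T) (\<lambda>\<alpha>. (S + T) (monomial \<alpha>))"
        using Phi(2)[OF S] Phi(2)[OF T] by (simp add: multiplier_seq_def fscale_def fun_eq_iff algebra_simps)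
    qed
  next
    fix c T assume T: "T \<in> carried_functionals \<Omega>"
    have cT: "fscale c T \<in> carried_functionals \<Omega>"
      using F.subspace_scale[OF sub(1) T] .
    show "Phi \<Omega> (fscale c T) = opscale c (Phi \<Omega> T)"
    proof (rule multipliers_eqI[OF \<Omega> Phi[OF cT]])
      show "opscale c (Phi \<Omega> T) \<in> multipliers \<Omega>"
        using O.subspace_scale[OF sub(2) Phi(1)[OF T]] .
      show "multiplier_seq \<Omega> (opscale c (Phi \<Omega> T)) (\<lambda>\<alpha>. fscale c T (monomial \<alpha>))"
        using Phi(2)[OF T] by (simp add: multiplier_seq_def fscale_def opscale_def fun_eq_iff)
    qed
  qed
qed

section \<open>Recovery of a functional from its multiplier\<close>

lemma nonempty_off_zero_coord:
  assumes "runge_domain \<Omega>"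
  obtains z where "z \<in> \<Omega> - zero_coord"
proof -
  obtain a where "a \<in> \<Omega>"
    using assms by (auto simp: runge_domain_def)
  then have "\<Omega> - zero_coord \<noteq> {}"
    using closure_diff_zero_coord[OF runge_domain_open[OF assms]] by force
  then show ?thesis
    using that by blast
qed

text \<open>At a point without zero coordinates no monomial vanishes, so the moments can be read off
  from the multiplier.\<close>

lemma Phi_inj_on:
  assumes \<Omega>: "runge_domain \<Omega>"
  shows "inj_on (Phi \<Omega>) (carried_functionals \<Omega>)"
proof (rule inj_onI)
  fix S T assume S: "S \<in> carried_functionals \<Omega>" and T: "T \<in> carried_functionals \<Omega>"
    and eq: "Phi \<Omega> S = Phi \<Omega> T"
  obtain z where z: "z \<in> \<Omega> - zero_coord"
    using nonempty_off_zero_coord[OF \<Omega>] .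
  have "S (monomial \<alpha>) = T (monomial \<alpha>)" for \<alpha>
  proof -
    have "fscale (S (monomial \<alpha>)) (restr \<Omega> (monomial \<alpha>)) z = fscale (T (monomial \<alpha>)) (restr \<Omega> (monomial \<alpha>)) z"
      using Phi_multiplier_seq[OF \<Omega> S] Phi_multiplier_seq[OF \<Omega> T] eq by (simp add: multiplier_seq_def)
    then show ?thesis
      using z monomial_nonzero[of z \<alpha>] by (simp add: fscale_def restr_def)
  qed
  then show "S = T"
    using S T by (intro hol_dual_eqI_moments[OF runge_domain_UNIV[OF \<Omega>]]) (auto simp: carried_functionals_def)
qed

section \<open>The functional of a multiplier\<close>

text \<open>The transpose of restriction from \<open>hol UNIV\<close> to \<open>hol U\<close>; the
  value 0 elsewhere follows the convention of \<open>hol_dual\<close>.\<close>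

definition pullback_functional ::
  "(complex ^ 'n) set \<Rightarrow> ((complex ^ 'n \<Rightarrow> complex) \<Rightarrow> complex) \<Rightarrow> (complex ^ 'n \<Rightarrow> complex) \<Rightarrow> complex" where
  "pullback_functional U S f = (if f \<in> hol UNIV then S (restr U f) else 0)"

lemma pullback_functional_hol_dual:
  fixes U :: "(complex ^ 'n) set"
  assumes S: "S \<in> hol_dual U" and U: "open U"
  shows "pullback_functional U S \<in> hol_dual UNIV"
    and "\<exists>K C. compact K \<and> K \<subseteq> U \<and> C \<ge> 0 \<and> dominated (hol UNIV) K C (pullback_functional U S)"
proof -
  obtain K C where K: "compact K" "K \<subseteq> U" "C \<ge> 0" "dominated (hol U) K C S"
    using hol_dual_dominated[OF S] .
  have r: "restr U f \<in> hol U" if "f \<in> hol UNIV" for f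
    using restr_hol[OF that U] by simp
  have dom: "dominated (hol UNIV) K C (pullback_functional U S)"
    unfolding dominated_def
  proof (intro ballI allI impI)
    fix f B assume f: "f \<in> hol UNIV" and B: "0 \<le> (B :: real)" "\<forall>z\<in>K. cmod (f z) \<le> B"
    have "cmod (S (restr U f)) \<le> C * B"
      using B K(2) by (intro dominatedD[OF K(4) r[OF f]]) (auto simp: restr_def)
    then show "cmod (pullback_functional U S f) \<le> C * B"
      using f by (simp add: pullback_functional_def)
  qed
  then show "\<exists>K C. compact K \<and> K \<subseteq> U \<and> C \<ge> 0 \<and> dominated (hol UNIV) K C (pullback_functional U S)"
    using K by blast
  have lin: "S (restr U f + restr U g) = S (restr U f) + S (restr U g)"
    "S (fscale c (restr U f)) = c * S (restr U f)" if "f \<in> hol UNIV" "g \<in> hol UNIV" for f g c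
    using hol_dual_lin[OF S] r that unfolding lin_on_def by auto
  have "restr U (f + g) = restr U f + restr U g" "restr U (fscale c f) = fscale c (restr U f)" for f g c
    by (auto simp: restr_def fscale_def fun_eq_iff)
  then have "lin_functional UNIV (pullback_functional U S)"
    using lin by (simp add: lin_on_def pullback_functional_def hol_add hol_fscale)
  then show "pullback_functional U S \<in> hol_dual UNIV"
    by (rule hol_dualI[OF _ dom K(3,1)]) (auto simp: pullback_functional_def)
qed

text \<open>Undilation by \<open>z\<close> multiplies a monomial by
  \<open>monomial \<alpha> (vinverse z)\<close>, evaluation at \<open>z\<close> by the reciprocal.
  The factors cancel, which frees the moments from \<open>z\<close>.\<close>

lemma multiplier_functional_at:
  fixes \<Omega> :: "(complex ^ 'n) set"
  assumes \<Omega>: "runge_domain \<Omega>" and M: "M \<in> multipliers \<Omega>" "multiplier_seq \<Omega> M m" and z: "z \<in> \<Omega> - zero_coord"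
  obtains S where "S \<in> hol_dual (inv_dilate z \<Omega>)"
    "\<And>\<alpha>. S (restr (inv_dilate z \<Omega>) (monomial \<alpha>)) = m \<alpha>"
proof -
  define U where "U = inv_dilate z \<Omega>"
  have U: "U = {w. z * w \<in> \<Omega>}" "open U"
    unfolding U_def using z runge_domain_open[OF \<Omega>] by (simp add: inv_dilate_eq, blast intro: open_inv_dilate)
  have zz: "z \<notin> zero_coord"
    using z by blast
  define S where "S = (\<lambda>f. if f \<in> hol U then M (\<lambda>w. f (vinverse z * w)) z else 0)"
  have und: "(\<lambda>w. f (vinverse z * w)) \<in> hol \<Omega>" if "f \<in> hol U" for f
    using that zz unfolding U_def by (rule hol_undilate)
  obtain Q C where Q: "compact Q" "Q \<subseteq> \<Omega>" "C \<ge> 0" "\<forall>w\<in>{z}. dominated (hol \<Omega>) Q C (\<lambda>f. M f w)"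
    using multipliers_dominated[OF M(1), of "{z}"] z by auto
  define K where "K = (\<lambda>w. vinverse z * w) ` Q"
  have K: "compact K" "K \<subseteq> U"
    unfolding K_def U(1) using Q zz by (auto intro!: compact_continuous_image continuous_intros)
  have Mlin: "lin_on fscale fscale (hol \<Omega>) M"
    using M(1) by (simp add: multipliers_def)
  have "S \<in> hol_dual U"
  proof (rule hol_dualI[OF _ _ Q(3) K])
    have add: "M ((\<lambda>w. f (vinverse z * w)) + (\<lambda>w. g (vinverse z * w))) =
        M (\<lambda>w. f (vinverse z * w)) + M (\<lambda>w. g (vinverse z * w))" if "f \<in> hol U" "g \<in> hol U" for f g
      using Mlin und[OF that(1)] und[OF that(2)] unfolding lin_on_def by blast
    have scale: "M (fscale c (\<lambda>w. f (vinverse z * w))) = fscale c (M (\<lambda>w. f (vinverse z * w)))"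
      if "f \<in> hol U" for f c
      using Mlin und[OF that] unfolding lin_on_def by blast
    have "S (f + g) = S f + S g" if "f \<in> hol U" "g \<in> hol U" for f g
      using add[OF that] that hol_add[OF that] by (simp add: S_def plus_fun_def)
    moreover have "S (fscale c f) = c * S f" if "f \<in> hol U" for f c
      using scale[OF that, of c] that hol_fscale[OF that, of c] by (simp add: S_def fscale_def)
    ultimately show "lin_functional U S"
      unfolding lin_on_def by blast
    show "dominated (hol U) K C S"
      unfolding dominated_def
    proof (intro ballI allI impI)
      fix f B assume f: "f \<in> hol U" and B: "0 \<le> (B :: real)" "\<forall>w\<in>K. cmod (f w) \<le> B"
      have "cmod (M (\<lambda>w. f (vinverse z * w)) z) \<le> C * B"
        using B Q(4) by (intro dominatedD[where T = "\<lambda>f. M f z", OF _ und[OF f]]) (auto simp: K_def)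
      then show "cmod (S f) \<le> C * B"
        using f by (simp add: S_def)
    qed
    show "S f = 0" if "f \<notin> hol U" for f
      using that by (simp add: S_def)
  qed
  moreover have "S (restr U (monomial \<alpha>)) = m \<alpha>" for \<alpha>
  proof -
    have hol: "restr U (monomial \<alpha>) \<in> hol U" "restr \<Omega> (monomial \<alpha>) \<in> hol \<Omega>"
      using restr_hol[OF monomial_hol] U(2) runge_domain_open[OF \<Omega>] by auto
    have "(\<lambda>w. restr U (monomial \<alpha>) (vinverse z * w)) = fscale (monomial \<alpha> (vinverse z)) (restr \<Omega> (monomial \<alpha>))"
      using zz by (auto simp: restr_def fscale_def monomial_dilate U(1) fun_eq_iff)
    moreover have "M (fscale (monomial \<alpha> (vinverse z)) (restr \<Omega> (monomial \<alpha>))) =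
        fscale (monomial \<alpha> (vinverse z)) (M (restr \<Omega> (monomial \<alpha>)))"
      using Mlin hol(2) unfolding lin_on_def by blast
    moreover have "monomial \<alpha> (vinverse z) * monomial \<alpha> z = 1"
      using monomial_dilate[of \<alpha> "vinverse z" z] vinverse_mult(2)[OF zz] by (simp add: monomial_def)
    ultimately show ?thesis
      using hol(1) z M(2) by (simp add: S_def multiplier_seq_def fscale_def restr_def mult.left_commute)
  qed
  ultimately show ?thesis
    using that unfolding U_def by blast
qed

text \<open>\<open>good z T\<close> ties a compact set in the dilate for \<open>z\<close> to the
  prescribed moments. Once equal moments identify the functionals for different \<open>z\<close>,
  all these compact sets belong to one \<open>T\<close>.\<close>

lemma multiplier_carried_functional:
  fixes \<Omega> :: "(complex ^ 'n) set"
  assumes \<Omega>: "runge_domain \<Omega>" and M: "M \<in> multipliers \<Omega>" "multiplier_seq \<Omega> M m"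
  obtains T where "T \<in> carried_functionals \<Omega>" "\<And>\<alpha>. T (monomial \<alpha>) = m \<alpha>"
proof -
  define good where "good = (\<lambda>z T. T \<in> hol_dual UNIV \<and> (\<forall>\<alpha>. T (monomial \<alpha>) = m \<alpha>) \<and>
    (\<exists>K C. compact K \<and> K \<subseteq> inv_dilate z \<Omega> \<and> C \<ge> 0 \<and> dominated (hol UNIV) K C T))"
  have good: "\<exists>T. good z T" if z: "z \<in> \<Omega> - zero_coord" for z
  proof -
    obtain S where S: "S \<in> hol_dual (inv_dilate z \<Omega>)"
      "\<And>\<alpha>. S (restr (inv_dilate z \<Omega>) (monomial \<alpha>)) = m \<alpha>"
      using multiplier_functional_at[OF \<Omega> M z] by blast
    have "open (inv_dilate z \<Omega>)"
      using z runge_domain_open[OF \<Omega>] by (intro open_inv_dilate) auto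
    then have "good z (pullback_functional (inv_dilate z \<Omega>) S)"
      unfolding good_def using pullback_functional_hol_dual[OF S(1)] S(2)
      by (simp add: pullback_functional_def[of _ _ "monomial _"] monomial_hol)
    then show ?thesis
      by blast
  qed
  obtain a where "a \<in> \<Omega> - zero_coord"
    using nonempty_off_zero_coord[OF \<Omega>] .
  then obtain T where T: "good a T"
    using good by blast
  have "good z T" if z: "z \<in> \<Omega> - zero_coord" for z
  proof -
    obtain T' where T': "good z T'"
      using good[OF z] by blast
    have "T' = T"
      using T T' by (intro hol_dual_eqI_moments[OF runge_domain_UNIV[OF \<Omega>]]) (auto simp: good_def)
    then show ?thesis
      using T' by simp
  qed
  then have "T \<in> carried_functionals \<Omega>"
    using T unfolding carried_functionals_iff[OF runge_domain_open[OF \<Omega>]] good_def by blast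
  moreover have "T (monomial \<alpha>) = m \<alpha>" for \<alpha>
    using T by (simp add: good_def)
  ultimately show ?thesis
    by (rule that)
qed

section \<open>Entire extensions and evaluation at the point 1\<close>

lemma inv_dilate_UNIV: "z \<notin> zero_coord \<Longrightarrow> inv_dilate z UNIV = UNIV"
  by (simp add: inv_dilate_eq)

text \<open>All dilates of the whole space coincide with it, so any bound of \<open>T\<close> is
  admissible for every \<open>z\<close>, and \<open>\<Phi>\<close> can be formed over the whole
  space.\<close>

lemma hol_dual_UNIV_carried:
  assumes "T \<in> hol_dual UNIV"
  shows "T \<in> carried_functionals UNIV"
  unfolding carried_functionals_iff[OF open_UNIV]
proof (intro conjI ballI assms)
  fix z :: "complex ^ 'a" assume z: "z \<in> UNIV - zero_coord"
  show "\<exists>K C. compact K \<and> K \<subseteq> inv_dilate z UNIV \<and> C \<ge> 0 \<and> dominated (hol UNIV) K C T"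
    by (rule hol_dual_dominated[OF assms]) (use z inv_dilate_UNIV[of z] in auto)
qed

text \<open>Over the whole space \<open>T\<^sub>z\<close> is \<open>T\<close> itself, so the entire
  function \<open>Phi UNIV T f\<close> takes the value \<open>T(f\<^sub>z)\<close> at points without
  zero coordinates. The point \<open>1\<close> is one of them, and there \<open>f\<^sub>z\<close> is
  \<open>f\<close>.\<close>

lemma entire_extension_Phi:
  assumes \<Omega>: "runge_domain \<Omega>" and T: "T \<in> carried_functionals \<Omega>" and f: "f \<in> hol UNIV"
  shows "entire_extension \<Omega> (Phi \<Omega> T (restr \<Omega> f)) (Phi UNIV T f)" "Phi UNIV T f 1 = T f"
proof -
  note op = runge_domain_open[OF \<Omega>] and R = runge_domain_UNIV[OF \<Omega>]
  have TD: "T \<in> hol_dual UNIV"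
    using T by (simp add: carried_functionals_def)
  then have TU: "T \<in> carried_functionals UNIV"
    by (rule hol_dual_UNIV_carried)
  have val: "Phi UNIV T f z = T (\<lambda>w. f (z * w))" if z: "z \<notin> zero_coord" for z
  proof -
    have "functional_at UNIV T z = T"
      using z TD by (intro functional_at_eq[OF R z]) (simp add: extends_functional_def inv_dilate_UNIV)
    then show ?thesis
      using Phi_apply[OF R TU f, of z] z by simp
  qed
  show "Phi UNIV T f 1 = T f"
    using val[of 1] by (simp add: zero_coord_def)
  have g: "Phi UNIV T f \<in> hol UNIV"
    using Phi_hol[OF R TU f] .
  have rf: "restr \<Omega> f \<in> hol \<Omega>"
    using restr_hol[OF f op] by simp
  have "restr \<Omega> (Phi UNIV T f) = Phi \<Omega> T (restr \<Omega> f)"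
  proof (rule hol_eqI_off_zero_coord[OF op])
    show "restr \<Omega> (Phi UNIV T f) \<in> hol \<Omega>" "Phi \<Omega> T (restr \<Omega> f) \<in> hol \<Omega>"
      using restr_hol[OF g op] Phi_hol[OF \<Omega> T rf] by auto
    fix z assume z: "z \<in> \<Omega> - zero_coord"
    \<comment> \<open>Dilating the restricted function gives the restriction of the entire
      \<open>f\<^sub>z\<close>, on which \<open>T\<^sub>z\<close> returns the value of
      \<open>T\<close>.\<close>
    have "(\<lambda>w. restr \<Omega> f (z * w)) = restr (inv_dilate z \<Omega>) (\<lambda>w. f (z * w))"
      using z by (auto simp: restr_def inv_dilate_eq fun_eq_iff)
    moreover have "(\<lambda>w. f (z * w)) \<in> hol UNIV"
      using hol_UNIV_affine[OF f, of 0 z] by simp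
    ultimately show "restr \<Omega> (Phi UNIV T f) z = Phi \<Omega> T (restr \<Omega> f) z"
      using functional_at_extends(2)[OF \<Omega> T z] z val[of z]
      by (simp add: Phi_apply[OF \<Omega> T rf z] extends_functional_def restr_def[of \<Omega> "Phi UNIV T f"])
  qed
  then show "entire_extension \<Omega> (Phi \<Omega> T (restr \<Omega> f)) (Phi UNIV T f)"
    using g unfolding entire_extension_def by (metis restr_def)
qed

lemma entire_extension_unique:
  assumes "runge_domain \<Omega>" "entire_extension \<Omega> h f" "entire_extension \<Omega> h g"
  shows "f = g"
  using assms by (intro hol_UNIV_eqI[of \<Omega>]) (auto simp: entire_extension_def runge_domain_def)

lemma delta_one_Phi:
  assumes \<Omega>: "runge_domain \<Omega>" and T: "T \<in> carried_functionals \<Omega>"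
  shows "delta_one \<Omega> (Phi \<Omega> T) = T"
proof
  fix f
  show "delta_one \<Omega> (Phi \<Omega> T) f = T f"
  proof (cases "f \<in> hol UNIV")
    case True
    have "(THE g. entire_extension \<Omega> (Phi \<Omega> T (restr \<Omega> f)) g) = Phi UNIV T f"
      using entire_extension_Phi(1)[OF \<Omega> T True] entire_extension_unique[OF \<Omega>] by (intro the_equality) auto
    then show ?thesis
      using True entire_extension_Phi(2)[OF \<Omega> T True] by (simp add: delta_one_def)
  next
    case False
    have "T \<in> hol_dual UNIV"
      using T by (simp add: carried_functionals_def)
    then show ?thesis
      using hol_dual_outside[OF _ False] False by (simp add: delta_one_def)
  qed
qed

lemma multiplier_eq_Phi:
  assumes \<Omega>: "runge_domain \<Omega>" and M: "M \<in> multipliers \<Omega>"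
  obtains T where "T \<in> carried_functionals \<Omega>" "Phi \<Omega> T = M"
proof -
  obtain m where m: "multiplier_seq \<Omega> M m"
    using M by (auto simp: multipliers_def)
  obtain T where T: "T \<in> carried_functionals \<Omega>" "\<And>\<alpha>. T (monomial \<alpha>) = m \<alpha>"
    using multiplier_carried_functional[OF \<Omega> M m] by blast
  have "Phi \<Omega> T = M"
    using Phi_multiplier_seq[OF \<Omega> T(1)] T(2)
    by (intro multipliers_eqI[OF \<Omega> Phi_multipliers[OF \<Omega> T(1)] _ M m]) simp
  then show ?thesis
    using that T(1) by blast
qed

theorem theorem3p1:
  fixes \<Omega> :: "(complex ^ 'n) set"
  assumes "runge_domain \<Omega>"
  shows "(\<forall>T\<in>carried_functionals \<Omega>. \<forall>z\<in>\<Omega> - zero_coord.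
            \<exists>!S. extends_functional (inv_dilate z \<Omega>) T S) \<and>
         (\<forall>T\<in>carried_functionals \<Omega>. \<forall>f\<in>hol \<Omega>. \<exists>!g. Phi_value \<Omega> T f g) \<and>
         (\<forall>T\<in>carried_functionals \<Omega>. \<forall>f\<in>hol \<Omega>. \<forall>z\<in>\<Omega> - zero_coord.
            Phi \<Omega> T f z = functional_at \<Omega> T z (\<lambda>w. f (z * w))) \<and>
         vs_iso fscale opscale (carried_functionals \<Omega>) (multipliers \<Omega>) (Phi \<Omega>) \<and>
         (\<forall>T\<in>carried_functionals \<Omega>. multiplier_seq \<Omega> (Phi \<Omega> T) (\<lambda>\<alpha>. T (monomial \<alpha>))) \<and>
         (\<forall>M\<in>multipliers \<Omega>.
            (\<forall>f\<in>hol UNIV. \<exists>!g. entire_extension \<Omega> (M (restr \<Omega> f)) g) \<and>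
            (1 \<in> \<Omega> \<longrightarrow> (\<forall>f\<in>hol UNIV. delta_one \<Omega> M f = M (restr \<Omega> f) 1)) \<and>
            delta_one \<Omega> M \<in> hol_dual UNIV \<and>
            (\<forall>z\<in>\<Omega> - zero_coord. \<exists>S. extends_functional (inv_dilate z \<Omega>) (delta_one \<Omega> M) S) \<and>
            delta_one \<Omega> M \<in> carried_functionals \<Omega> \<and>
            Phi \<Omega> (delta_one \<Omega> M) = M \<and>
            inv_into (carried_functionals \<Omega>) (Phi \<Omega>) M = delta_one \<Omega> M)"
proof (intro conjI)
  note op = runge_domain_open[OF assms]
  show "\<forall>T\<in>carried_functionals \<Omega>. \<forall>z\<in>\<Omega> - zero_coord. \<exists>!S. extends_functional (inv_dilate z \<Omega>) T S"
    by (intro ballI functional_at_extends(1)[OF assms])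
  show "\<forall>T\<in>carried_functionals \<Omega>. \<forall>f\<in>hol \<Omega>. \<exists>!g. Phi_value \<Omega> T f g"
    using Phi_value_Phi[OF assms] Phi_value_unique[OF op] by blast
  show "\<forall>T\<in>carried_functionals \<Omega>. \<forall>f\<in>hol \<Omega>. \<forall>z\<in>\<Omega> - zero_coord.
      Phi \<Omega> T f z = functional_at \<Omega> T z (\<lambda>w. f (z * w))"
    by (intro ballI Phi_apply[OF assms])
  show "\<forall>T\<in>carried_functionals \<Omega>. multiplier_seq \<Omega> (Phi \<Omega> T) (\<lambda>\<alpha>. T (monomial \<alpha>))"
    by (intro ballI Phi_multiplier_seq[OF assms])
  have "Phi \<Omega> ` carried_functionals \<Omega> = multipliers \<Omega>"
    using Phi_multipliers[OF assms] multiplier_eq_Phi[OF assms] by blast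
  then show "vs_iso fscale opscale (carried_functionals \<Omega>) (multipliers \<Omega>) (Phi \<Omega>)"
    using subspace_carried_functionals[OF op] subspace_multipliers Phi_linear[OF assms] Phi_inj_on[OF assms]
    by (simp add: vs_iso_def bij_betw_def)
  show "\<forall>M\<in>multipliers \<Omega>.
            (\<forall>f\<in>hol UNIV. \<exists>!g. entire_extension \<Omega> (M (restr \<Omega> f)) g) \<and>
            (1 \<in> \<Omega> \<longrightarrow> (\<forall>f\<in>hol UNIV. delta_one \<Omega> M f = M (restr \<Omega> f) 1)) \<and>
            delta_one \<Omega> M \<in> hol_dual UNIV \<and>
            (\<forall>z\<in>\<Omega> - zero_coord. \<exists>S. extends_functional (inv_dilate z \<Omega>) (delta_one \<Omega> M) S) \<and>
            delta_one \<Omega> M \<in> carried_functionals \<Omega> \<and>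
            Phi \<Omega> (delta_one \<Omega> M) = M \<and>
            inv_into (carried_functionals \<Omega>) (Phi \<Omega>) M = delta_one \<Omega> M"
  proof
    fix M assume M: "M \<in> multipliers \<Omega>"
    obtain T where T: "T \<in> carried_functionals \<Omega>" "Phi \<Omega> T = M"
      using multiplier_eq_Phi[OF assms M] .
    \<comment> \<open>With this identity every clause about evaluation at 1 becomes a property of
      the carried functional \<open>T\<close>.\<close>
    have d: "delta_one \<Omega> M = T"
      using delta_one_Phi[OF assms T(1)] T(2) by simp
    have ext: "entire_extension \<Omega> (M (restr \<Omega> f)) (Phi UNIV T f)" "Phi UNIV T f 1 = T f"
      if "f \<in> hol UNIV" for f
      using entire_extension_Phi[OF assms T(1) that] T(2) by simp_all
    show "(\<forall>f\<in>hol UNIV. \<exists>!g. entire_extension \<Omega> (M (restr \<Omega> f)) g) \<and>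
            (1 \<in> \<Omega> \<longrightarrow> (\<forall>f\<in>hol UNIV. delta_one \<Omega> M f = M (restr \<Omega> f) 1)) \<and>
            delta_one \<Omega> M \<in> hol_dual UNIV \<and>
            (\<forall>z\<in>\<Omega> - zero_coord. \<exists>S. extends_functional (inv_dilate z \<Omega>) (delta_one \<Omega> M) S) \<and>
            delta_one \<Omega> M \<in> carried_functionals \<Omega> \<and>
            Phi \<Omega> (delta_one \<Omega> M) = M \<and>
            inv_into (carried_functionals \<Omega>) (Phi \<Omega>) M = delta_one \<Omega> M"
      unfolding d
    proof (intro conjI)
      show "\<forall>f\<in>hol UNIV. \<exists>!g. entire_extension \<Omega> (M (restr \<Omega> f)) g"
        using ext(1) entire_extension_unique[OF assms] by blast
      show "1 \<in> \<Omega> \<longrightarrow> (\<forall>f\<in>hol UNIV. T f = M (restr \<Omega> f) 1)"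
        using ext by (metis entire_extension_def)
      show "T \<in> hol_dual UNIV"
        using T(1) by (simp add: carried_functionals_def)
      show "\<forall>z\<in>\<Omega> - zero_coord. \<exists>S. extends_functional (inv_dilate z \<Omega>) T S"
        using functional_at_extends(2)[OF assms T(1)] by blast
      show "inv_into (carried_functionals \<Omega>) (Phi \<Omega>) M = T"
        using inv_into_f_f[OF Phi_inj_on[OF assms] T(1)] T(2) by simp
    qed (use T in auto)
  qed
qed

end
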